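(* Let $K=\mathbb{Q}_2(\sqrt{5})$ and let $d=2m$ with $m\ge3$ odd. Then every additive form $a_1x_1^d+\dots+a_sx_s^d$ with $a_i\in K$ in $s\ge 5d+1$ variables has a nontrivial zero in $K$; i.e. $\Gamma^*(d,K)\le 5d+1$.
   Context: A nontrivial zero is a point $(x_1,\dots,x_s)\in K^s\setminus\{0\}$ at which the form vanishes. $\Gamma^*(d,K)$ denotes the least integer $N$ such that every additive form of degree $d$ over $K$ in at least $N$ variables has a nontrivial zero in $K$. *)

theory Defs
  imports Complex_Main "HOL-Computational_Algebra.Fraction_Field"
begin

text \<open>
  The ring of 2-adic integers is the inverse limit of the rings \<open>\<int> / 2\<^sup>n\<int>\<close>: an element is a
  coherent sequence of residues, the \<open>n\<close>-th one being represented in \<open>{0..<2^n}\<close> (the equation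
  \<open>f n = f (Suc n) mod 2 ^ n\<close> enforces both the coherence and the range).
\<close>

typedef z2 = "{f :: nat \<Rightarrow> int. \<forall>n. f n = f (Suc n) mod 2 ^ n}"
  morphisms residue Abs_z2
  by (rule exI[of _ "\<lambda>_. 0"]) simp

setup_lifting type_definition_z2

lemma mod_Suc_mod: "a mod 2 ^ Suc n mod 2 ^ n = a mod (2 ^ n :: int)"
  by (rule mod_mod_cancel) simp

lemma coherent_mod:
  assumes "\<And>n. f n = f (Suc n) mod (2 ^ n :: int)"
  shows "f n mod 2 ^ n = f (Suc n) mod 2 ^ n"
proof -
  have "f n = f (Suc n) mod 2 ^ n" by (rule assms)
  then show ?thesis by (metis mod_mod_trivial)
qed

lemma z2_eqI: "(\<And>n. residue x n = residue y n) \<Longrightarrow> x = y"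
  by (simp add: fun_eq_iff flip: residue_inject)

lemma residue_Suc_mod: "residue x (Suc n) mod 2 ^ n = residue x n"
  using CollectD[OF residue[of x], rule_format, of n] by (rule sym)

lemma residue_mod_self [simp]: "residue x n mod 2 ^ n = residue x n"
  by (metis mod_mod_trivial residue_Suc_mod)

lemma residue_add_mod: "residue x (n + k) mod 2 ^ n = residue x n"
proof (induction k)
  case (Suc k)
  have "residue x (n + Suc k) mod 2 ^ n = residue x (Suc (n + k)) mod 2 ^ (n + k) mod 2 ^ n"
    by (simp add: mod_mod_cancel le_imp_power_dvd)
  then show ?case
    using Suc by (simp add: residue_Suc_mod)
qed simp

instantiation z2 :: comm_ring_1
begin

lift_definition zero_z2 :: z2 is "\<lambda>n. 0" by simp

lift_definition one_z2 :: z2 is "\<lambda>n. 1 mod 2 ^ n"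
  by (simp only: mod_Suc_mod)

lift_definition plus_z2 :: "z2 \<Rightarrow> z2 \<Rightarrow> z2" is "\<lambda>f g n. (f n + g n) mod 2 ^ n"
  subgoal premises prems for f g n
    unfolding mod_Suc_mod
    by (rule mod_add_cong[OF coherent_mod[of f, OF prems(1)] coherent_mod[of g, OF prems(2)]])
  done

lift_definition minus_z2 :: "z2 \<Rightarrow> z2 \<Rightarrow> z2" is "\<lambda>f g n. (f n - g n) mod 2 ^ n"
  subgoal premises prems for f g n
    unfolding mod_Suc_mod
    by (rule mod_diff_cong[OF coherent_mod[of f, OF prems(1)] coherent_mod[of g, OF prems(2)]])
  done

lift_definition times_z2 :: "z2 \<Rightarrow> z2 \<Rightarrow> z2" is "\<lambda>f g n. (f n * g n) mod 2 ^ n"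
  subgoal premises prems for f g n
    unfolding mod_Suc_mod
    by (rule mod_mult_cong[OF coherent_mod[of f, OF prems(1)] coherent_mod[of g, OF prems(2)]])
  done

lift_definition uminus_z2 :: "z2 \<Rightarrow> z2" is "\<lambda>f n. (- f n) mod 2 ^ n"
  subgoal premises prems for f n
    unfolding mod_Suc_mod
    by (rule mod_minus_cong[OF coherent_mod[of f, OF prems]])
  done

lemmas residue_simps = zero_z2.rep_eq one_z2.rep_eq plus_z2.rep_eq minus_z2.rep_eq
  uminus_z2.rep_eq times_z2.rep_eq

instance
proof
  fix a b c :: z2
  show "a + b + c = a + (b + c)"
    by (rule z2_eqI) (simp add: residue_simps mod_simps add.assoc)
  show "a + b = b + a"
    by (rule z2_eqI) (simp add: residue_simps add.commute)
  show "0 + a = a"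
    by (rule z2_eqI) (simp add: residue_simps)
  show "- a + a = 0"
    by (rule z2_eqI) (simp add: residue_simps mod_simps)
  show "a - b = a + - b"
    by (rule z2_eqI) (simp add: residue_simps mod_simps)
  show "a * b * c = a * (b * c)"
    by (rule z2_eqI) (simp add: residue_simps mod_simps mult.assoc)
  show "a * b = b * a"
    by (rule z2_eqI) (simp add: residue_simps mult.commute)
  show "1 * a = a"
    by (rule z2_eqI) (simp only: residue_simps mod_mult_left_eq mult_1 residue_mod_self)
  show "(a + b) * c = a * c + b * c"
    by (rule z2_eqI) (simp add: residue_simps mod_simps distrib_right)
  show "(0::z2) \<noteq> 1"
  proof
    assume "(0::z2) = 1"
    then have "residue 0 1 = residue 1 1" by simp
    then show False by (simp add: zero_z2.rep_eq one_z2.rep_eq)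
  qed
qed

end

lemma z2_eq_0_iff: "x = 0 \<longleftrightarrow> (\<forall>n. residue x n = 0)"
  by (metis z2_eqI zero_z2.rep_eq)

lemma not_power2_dvd_mult:
  fixes a b :: int
  assumes "\<not> 2 ^ k dvd a" "\<not> 2 ^ l dvd b"
  shows "\<not> 2 ^ (k + l) dvd a * b"
  using assms
proof (induction k arbitrary: a)
  case (Suc k)
  show ?case
  proof (cases "even a")
    case True
    then obtain c where a: "a = 2 * c" by blast
    then have "\<not> 2 ^ k dvd c" using Suc.prems by simp
    then show ?thesis using Suc.IH[of c] Suc.prems by (simp add: a mult.assoc)
  next
    case False
    then have "coprime (2 ^ (Suc k + l)) a" by simp
    then have "2 ^ (Suc k + l) dvd a * b \<longleftrightarrow> (2::int) ^ (Suc k + l) dvd b"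
      by (simp add: coprime_dvd_mult_right_iff)
    moreover have "(2::int) ^ l dvd 2 ^ (Suc k + l)" by (rule le_imp_power_dvd) simp
    ultimately show ?thesis using Suc.prems dvd_trans by blast
  qed
qed simp

instance z2 :: idom
proof
  fix a b :: z2
  assume "a \<noteq> 0" "b \<noteq> 0"
  then obtain k l where kl: "residue a k \<noteq> 0" "residue b l \<noteq> 0"
    by (auto simp: z2_eq_0_iff)
  have "\<not> 2 ^ k dvd residue a (k + l)"
    using kl by (simp add: dvd_eq_mod_eq_0 residue_add_mod)
  moreover have "\<not> 2 ^ l dvd residue b (k + l)"
    using kl residue_add_mod[of b l k] by (simp add: dvd_eq_mod_eq_0 add.commute)
  ultimately have "residue (a * b) (k + l) \<noteq> 0"
    using not_power2_dvd_mult by (simp add: times_z2.rep_eq dvd_eq_mod_eq_0)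
  then show "a * b \<noteq> 0" by (auto simp: z2_eq_0_iff)
qed

type_synonym q2 = "z2 fract"

lemma five_nonsquare_aux:
  fixes a b :: int
  assumes "2 ^ (2 * n + 3) dvd a\<^sup>2 - 5 * b\<^sup>2"
  shows "2 ^ n dvd b"
  using assms
proof (induction n arbitrary: a b)
  case (Suc n)
  have "(8::int) dvd 2 ^ (2 * Suc n + 3)"
    using le_imp_power_dvd[of 3 "2 * Suc n + 3" "2::int"] by simp
  then have 8: "8 dvd a\<^sup>2 - 5 * b\<^sup>2" using Suc.prems dvd_trans by blast
  have "even a \<and> even b"
  proof -
    have sq: "x\<^sup>2 mod 8 = 1" if "odd x" for x :: int
    proof -
      obtain y where y: "x = 2 * y + 1" using \<open>odd x\<close> by (auto elim: oddE)
      have "even (y * (y + 1))" by simp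
      then obtain z where "y * (y + 1) = 2 * z" by blast
      then have "x\<^sup>2 = 8 * z + 1" by (simp add: y power2_eq_square algebra_simps)
      then show ?thesis by simp
    qed
    have "even (a\<^sup>2 - 5 * b\<^sup>2)" using 8 by presburger
    then have par: "even a \<longleftrightarrow> even b" by simp
    show ?thesis
    proof (rule ccontr)
      assume "\<not> ?thesis"
      then have "a\<^sup>2 mod 8 = 1" "b\<^sup>2 mod 8 = 1" using par sq by auto
      then show False using 8 by presburger
    qed
  qed
  then obtain a' b' where ab: "a = 2 * a'" "b = 2 * b'" by blast
  have "a\<^sup>2 - 5 * b\<^sup>2 = 4 * (a'\<^sup>2 - 5 * b'\<^sup>2)"
    by (simp add: ab power2_eq_square)
  moreover have "(2::int) ^ (2 * Suc n + 3) = 4 * 2 ^ (2 * n + 3)" by (simp add: power_add)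
  ultimately have "2 ^ (2 * n + 3) dvd a'\<^sup>2 - 5 * b'\<^sup>2"
    using Suc.prems by (metis dvd_mult_cancel_left zero_neq_numeral)
  then show ?case using Suc.IH by (simp add: ab)
qed simp

lemma residue_of_nat: "residue (of_nat k) n = int k mod 2 ^ n"
proof (induction k)
  case (Suc k)
  have "residue (of_nat (Suc k)) n = (1 mod 2 ^ n + int k mod 2 ^ n) mod 2 ^ n"
    by (simp only: of_nat_Suc plus_z2.rep_eq one_z2.rep_eq Suc)
  then show ?case by (simp only: mod_add_eq of_nat_Suc)
qed (simp add: zero_z2.rep_eq)

lemma five_nonsquare_z2:
  fixes a b :: z2
  assumes "a * a = 5 * (b * b)"
  shows "b = 0"
proof -
  have "residue b n = 0" for n
  proof -
    let ?N = "n + (n + 3)"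
    have five: "residue 5 ?N = 5 mod 2 ^ ?N"
      using residue_of_nat[of 5 ?N] by simp
    have "residue (a * a) ?N = residue (5 * (b * b)) ?N" by (simp add: assms)
    then have "(residue a ?N)\<^sup>2 mod 2 ^ ?N = (5 * (residue b ?N)\<^sup>2) mod 2 ^ ?N"
      unfolding times_z2.rep_eq five by (simp only: mod_simps power2_eq_square)
    then have "2 ^ ?N dvd (residue a ?N)\<^sup>2 - 5 * (residue b ?N)\<^sup>2"
      by (simp add: mod_eq_dvd_iff)
    moreover have "?N = 2 * n + 3" by simp
    ultimately have "2 ^ n dvd residue b ?N"
      using five_nonsquare_aux by metis
    then show ?thesis by (simp only: dvd_eq_mod_eq_0 residue_add_mod)
  qed
  then show ?thesis by (simp add: z2_eq_0_iff)
qed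

lemma Fract_numeral_one: "(numeral k :: 'a::idom fract) = Fract (numeral k) 1"
  by (metis of_nat_fract of_nat_numeral)

lemma five_nonsquare_q2:
  fixes x y :: q2
  assumes "x * x = 5 * (y * y)"
  shows "x = 0 \<and> y = 0"
proof -
  have nonsq: "z * z \<noteq> 5" for z :: q2
  proof
    assume z: "z * z = 5"
    obtain a b where ab: "z = Fract a b" "b \<noteq> 0" by (cases z) auto
    have "a * a = 5 * (b * b)"
      using z ab by (simp add: Fract_numeral_one eq_fract)
    then show False using ab five_nonsquare_z2 by blast
  qed
  have "y = 0"
  proof (rule ccontr)
    assume "y \<noteq> 0"
    then have "(x / y) * (x / y) = 5" using assms by (simp add: field_simps)
    then show False using nonsq by blast
  qed
  then show ?thesis using assms by simp
qed

text \<open>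
  \<open>K = \<rat>\<^sub>2(\<surd>5)\<close>: the element \<open>Q2_sqrt5 a b\<close> is \<open>a + b \<surd>5\<close>. This is a field because 5 is not a
  square in \<open>\<rat>\<^sub>2\<close>.
\<close>

datatype q2_sqrt5 = Q2_sqrt5 (rat_part: q2) (sqrt_part: q2)

lemma q2_sqrt5_eqI: "rat_part x = rat_part y \<Longrightarrow> sqrt_part x = sqrt_part y \<Longrightarrow> x = y"
  by (rule q2_sqrt5.expand) simp

instantiation q2_sqrt5 :: field
begin

definition "0 = Q2_sqrt5 0 0"
definition "1 = Q2_sqrt5 1 0"
definition "x + y = Q2_sqrt5 (rat_part x + rat_part y) (sqrt_part x + sqrt_part y)"
definition "x - y = Q2_sqrt5 (rat_part x - rat_part y) (sqrt_part x - sqrt_part y)"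
definition "- x = Q2_sqrt5 (- rat_part x) (- sqrt_part x)"
definition "x * y = Q2_sqrt5
  (rat_part x * rat_part y + 5 * (sqrt_part x * sqrt_part y))
  (rat_part x * sqrt_part y + sqrt_part x * rat_part y)"
definition "inverse x =
  (let n = rat_part x * rat_part x - 5 * (sqrt_part x * sqrt_part x)
   in Q2_sqrt5 (rat_part x / n) (- sqrt_part x / n))"
definition "x div y = x * inverse (y :: q2_sqrt5)"

lemmas q2_sqrt5_ring_defs = zero_q2_sqrt5_def one_q2_sqrt5_def plus_q2_sqrt5_def
  minus_q2_sqrt5_def uminus_q2_sqrt5_def times_q2_sqrt5_def

instance
proof
  fix x y z :: q2_sqrt5
  show "x + y + z = x + (y + z)" "x + y = y + x" "0 + x = x" "- x + x = 0" "x - y = x + - y"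
    "x * y = y * x" "1 * x = x" "(0 :: q2_sqrt5) \<noteq> 1"
    by (simp_all add: q2_sqrt5_ring_defs algebra_simps)
  show "x * y * z = x * (y * z)" "(x + y) * z = x * z + y * z"
    by (simp_all add: q2_sqrt5_ring_defs algebra_simps)
  show "x div y = x * inverse y"
    by (rule divide_q2_sqrt5_def)
next
  fix x :: q2_sqrt5
  assume x: "x \<noteq> 0"
  define n where "n = rat_part x * rat_part x - 5 * (sqrt_part x * sqrt_part x)"
  have "n \<noteq> 0"
  proof
    assume "n = 0"
    then have "rat_part x * rat_part x = 5 * (sqrt_part x * sqrt_part x)"
      unfolding n_def by (rule eq_iff_diff_eq_0[THEN iffD2])
    then have "rat_part x = 0 \<and> sqrt_part x = 0" by (rule five_nonsquare_q2)
    then show False using x by (simp add: zero_q2_sqrt5_def q2_sqrt5_eqI)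
  qed
  have "rat_part x / n * rat_part x + 5 * (- sqrt_part x / n * sqrt_part x)
      = (rat_part x * rat_part x - 5 * (sqrt_part x * sqrt_part x)) / n"
    by (simp add: diff_divide_distrib)
  also have "\<dots> = 1" using \<open>n \<noteq> 0\<close> by (simp flip: n_def)
  finally have "rat_part x / n * rat_part x + 5 * (- sqrt_part x / n * sqrt_part x) = 1" .
  then show "inverse x * x = 1"
    by (simp add: times_q2_sqrt5_def one_q2_sqrt5_def inverse_q2_sqrt5_def Let_def
        flip: n_def)
next
  show "inverse (0 :: q2_sqrt5) = 0"
    by (simp add: inverse_q2_sqrt5_def zero_q2_sqrt5_def)
qed

end

lemma sqrt5_squared: "(Q2_sqrt5 0 1)\<^sup>2 = 5"
proof -
  have "of_nat k = Q2_sqrt5 (of_nat k) 0" for k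
    by (induction k) (simp_all add: zero_q2_sqrt5_def one_q2_sqrt5_def plus_q2_sqrt5_def)
  from this[of 5] show ?thesis
    by (simp add: power2_eq_square times_q2_sqrt5_def)
qed

text \<open>
  The additive form of degree \<open>d\<close> in \<open>s\<close> variables with coefficients \<open>a 0, \<dots>, a (s - 1)\<close>; only the
  values of \<open>a\<close> and \<open>x\<close> below \<open>s\<close> matter.
\<close>

definition additive_form :: "nat \<Rightarrow> nat \<Rightarrow> (nat \<Rightarrow> 'k::field) \<Rightarrow> (nat \<Rightarrow> 'k) \<Rightarrow> 'k" where
  "additive_form d s a x = (\<Sum>i<s. a i * x i ^ d)"

definition has_nontrivial_zero :: "nat \<Rightarrow> nat \<Rightarrow> (nat \<Rightarrow> 'k::field) \<Rightarrow> bool" where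
  "has_nontrivial_zero d s a \<longleftrightarrow> (\<exists>x. (\<exists>i<s. x i \<noteq> 0) \<and> additive_form d s a x = 0)"

text \<open>
  \<open>\<Gamma>\<^sup>*(d, K)\<close>, where the field \<open>K\<close> is given as a type. The value is only meaningful when some \<open>N\<close>
  with the stated property exists.
\<close>

definition Gamma_star :: "nat \<Rightarrow> 'k::field itself \<Rightarrow> nat" where
  "Gamma_star d K =
    (LEAST N. \<forall>s\<ge>N. \<forall>a :: nat \<Rightarrow> 'k. has_nontrivial_zero d s a)"

end

theory Submission
  imports Defs
begin

text \<open>
  After scaling, every coefficient is \<open>2\<^sup>l u\<close> with \<open>u\<close> a unit of \<open>\<int>\<^sub>2[\<phi>]\<close> and \<open>0 \<le> l < d\<close>. Since the levels
  \<open>l\<close> may be rotated cyclically, more than \<open>5d\<close> variables give a level with \<open>m\<^sub>0 \<ge> 6\<close> variables that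
  together with the \<open>m\<^sub>1\<close> variables on the next level satisfies \<open>m\<^sub>0 + m\<^sub>1 \<ge> 11\<close>. By Hensel's lemma it
  suffices to solve the equation modulo 8, with a variable of the lowest level nonzero and each
  \<open>x\<^sup>d\<close> equal to 0, 1 or 5.
  A subset sum divisible by 4 is enough if the chosen lowest coefficients have at least two different
  residues in the field with 4 elements, because then the choices between 1 and 5 reach every
  multiple of 4; if all of them are congruent to \<open>a\<close>, the quarter of the sum has to be 0 or \<open>a\<close> modulo 2.
  Such sums are found with the Davenport constants 5 and 7 of \<open>\<int>/4 \<times> \<int>/2\<close> and \<open>\<int>/4 \<times> \<int>/4\<close>, the
  groups being presented as quotients of lattices \<open>\<int>a + 2\<^sup>j \<int>\<^sub>2[\<phi>]\<close>. In the one case where this fails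
  (\<open>m\<^sub>0 = 6\<close> and the units of the next level congruent modulo 4 up to sign), the variables of the
  next level alone have a zero.
\<close>

section \<open>The ring of integers\<close>

lemma residue_power2_dvd:
  assumes "2 ^ n dvd (x :: z2)"
  shows "residue x n = 0"
proof -
  obtain y where y: "x = 2 ^ n * y" using assms by blast
  have "residue (2 ^ n) n = 0"
    using residue_of_nat[of "2 ^ n" n] by simp
  then show ?thesis by (simp add: y times_z2.rep_eq)
qed

text \<open>Halving costs one binary digit, so the residues of the half are the halved residues of
  \<open>x\<close> shifted by one place.\<close>

lemma z2_halve:
  assumes "residue x 1 = 0"
  obtains y where "x = 2 * y" "\<And>n. residue y n = residue x (Suc n) div 2"
proof -
  have ev: "2 * (residue x (Suc n) div 2) = residue x (Suc n)" for n
  proof -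
    have "residue x (Suc n) mod 2 = 0"
      using residue_add_mod[of x 1 n] assms by simp
    then show ?thesis by presburger
  qed
  have coh: "residue x (Suc n) div 2 = (residue x (Suc (Suc n)) div 2) mod 2 ^ n" for n
  proof -
    have "2 * ((residue x (Suc (Suc n)) div 2) mod 2 ^ n)
        = (2 * (residue x (Suc (Suc n)) div 2)) mod 2 ^ Suc n"
      by simp
    also have "\<dots> = residue x (Suc n)"
      by (simp only: ev residue_Suc_mod)
    finally show ?thesis by simp
  qed
  define y where "y = Abs_z2 (\<lambda>n. residue x (Suc n) div 2)"
  have y: "residue y n = residue x (Suc n) div 2" for n
  proof -
    have "(\<lambda>n. residue x (Suc n) div 2) \<in> {f. \<forall>n. f n = f (Suc n) mod 2 ^ n}" using coh by blast
    then show ?thesis unfolding y_def by (simp only: Abs_z2_inverse)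
  qed
  have "x = y + y"
  proof (rule z2_eqI)
    fix n
    have "residue (y + y) n = (2 * (residue x (Suc n) div 2)) mod 2 ^ n"
      by (simp only: plus_z2.rep_eq y mult_2)
    also have "\<dots> = residue x n" by (simp only: ev residue_Suc_mod)
    finally show "residue x n = residue (y + y) n" by simp
  qed
  then show ?thesis using that y by (metis mult_2)
qed

lemma z2_power2_dvd_iff: "2 ^ n dvd (x :: z2) \<longleftrightarrow> residue x n = 0"
proof
  show "residue x n = 0 \<Longrightarrow> 2 ^ n dvd x"
  proof (induction n arbitrary: x)
    case (Suc n)
    have "residue x 1 = residue x (1 + n) mod 2 ^ 1"
      by (simp only: residue_add_mod)
    then have "residue x 1 = 0" using Suc.prems by simp
    then obtain y where y: "x = 2 * y" "\<And>n. residue y n = residue x (Suc n) div 2"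
      by (rule z2_halve) blast
    have "2 ^ n dvd y" using Suc by (simp add: y(2))
    then show ?case by (simp add: y(1))
  qed simp
qed (rule residue_power2_dvd)

lemma z2_odd_iff: "\<not> 2 dvd x \<longleftrightarrow> residue x 1 = 1"
proof -
  have "residue x 1 = residue x 1 mod 2" using residue_mod_self[of x 1] by simp
  then have "residue x 1 = 0 \<or> residue x 1 = 1" by presburger
  then show ?thesis using z2_power2_dvd_iff[of 1 x] by auto
qed

lemma z2_even_add_iff: "2 dvd (x + y :: z2) \<longleftrightarrow> (2 dvd x \<longleftrightarrow> 2 dvd y)"
proof -
  have "residue (x + y) 1 = (residue x 1 + residue y 1) mod 2"
    by (simp add: plus_z2.rep_eq)
  then show ?thesis
    using z2_odd_iff[of x] z2_odd_iff[of y] z2_odd_iff[of "x + y"]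
      z2_power2_dvd_iff[of 1 x] z2_power2_dvd_iff[of 1 y] z2_power2_dvd_iff[of 1 "x + y"]
    by auto
qed

lemma z2_odd_one: "\<not> 2 dvd (1 :: z2)"
  by (simp add: z2_odd_iff one_z2.rep_eq)

text \<open>From \<open>X n\<close> on the \<open>n\<close>-th residue no longer changes, so the
  diagonal of the residues is coherent and defines the limit.\<close>

lemma z2_complete:
  fixes X :: "nat \<Rightarrow> z2"
  assumes "\<And>n. 2 ^ n dvd X (Suc n) - X n"
  obtains L where "\<And>n. 2 ^ n dvd L - X n"
proof -
  have res: "residue y n = residue z n" if "2 ^ n dvd y - z" for y z :: z2 and n
  proof -
    have "(residue y n - residue z n) mod 2 ^ n = 0"
      using that by (simp add: z2_power2_dvd_iff minus_z2.rep_eq)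
    then have "residue y n mod 2 ^ n = residue z n mod 2 ^ n"
      by (simp only: mod_eq_dvd_iff dvd_eq_mod_eq_0)
    then show ?thesis by (simp only: residue_mod_self)
  qed
  define L where "L = Abs_z2 (\<lambda>n. residue (X n) n)"
  have L: "residue L n = residue (X n) n" for n
  proof -
    have "residue (X n) n = residue (X (Suc n)) (Suc n) mod 2 ^ n" for n
      by (simp only: residue_Suc_mod res[OF assms])
    then have "(\<lambda>n. residue (X n) n) \<in> {f. \<forall>n. f n = f (Suc n) mod 2 ^ n}" by blast
    then show ?thesis unfolding L_def by (simp only: Abs_z2_inverse)
  qed
  have "2 ^ n dvd L - X n" for n
    by (simp add: z2_power2_dvd_iff minus_z2.rep_eq L)
  then show ?thesis by (rule that)
qed

text \<open>\<open>\<int>\<^sub>2[\<phi>]\<close> with \<open>\<phi>\<^sup>2 = \<phi> + 1\<close> is the ring of integers of \<open>\<rat>\<^sub>2(\<surd>5)\<close>, where \<open>\<phi> = (1 + \<surd>5) / 2\<close>;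
  \<open>Z2_phi x y\<close> is \<open>x + y \<phi>\<close>.\<close>

datatype z2_phi = Z2_phi (const_part: z2) (phi_part: z2)

lemma z2_phi_eqI: "const_part x = const_part y \<Longrightarrow> phi_part x = phi_part y \<Longrightarrow> x = y"
  by (rule z2_phi.expand) simp

instantiation z2_phi :: comm_ring_1
begin

definition "0 = Z2_phi 0 0"
definition "1 = Z2_phi 1 0"
definition "x + y = Z2_phi (const_part x + const_part y) (phi_part x + phi_part y)"
definition "x - y = Z2_phi (const_part x - const_part y) (phi_part x - phi_part y)"
definition "- x = Z2_phi (- const_part x) (- phi_part x)"
definition "x * y = Z2_phi
  (const_part x * const_part y + phi_part x * phi_part y)
  (const_part x * phi_part y + phi_part x * const_part y + phi_part x * phi_part y)"

lemmas z2_phi_ring_defs = zero_z2_phi_def one_z2_phi_def plus_z2_phi_def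
  minus_z2_phi_def uminus_z2_phi_def times_z2_phi_def

instance
  by standard (simp_all add: z2_phi_ring_defs algebra_simps)

end

section \<open>The embedding \<open>x + y \<phi> = (x + y/2) + (y/2) \<surd>5\<close> of the ring of
  integers into \<open>K\<close>\<close>

definition to_K :: "z2_phi \<Rightarrow> q2_sqrt5" where
  "to_K x = Q2_sqrt5 (Fract (const_part x) 1 + Fract (phi_part x) 1 / 2) (Fract (phi_part x) 1 / 2)"

lemma z2_two_neq_0: "(2 :: z2) \<noteq> 0"
proof
  assume "(2 :: z2) = 0"
  then have "residue 2 2 = residue 0 2" by simp
  then show False using residue_of_nat[of 2 2] by (simp add: zero_z2.rep_eq)
qed

lemma q2_two_neq_0: "(2 :: q2) \<noteq> 0"
proof
  assume "(2 :: q2) = 0"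
  then have "Fract (2 :: z2) 1 = Fract 0 1" by (simp only: Fract_numeral_one Zero_fract_def)
  then show False using z2_two_neq_0 by (simp add: eq_fract(1) del: fract_collapse)
qed

lemma Fract_one_add: "Fract (x + y) 1 = Fract x 1 + Fract y 1"
  and Fract_one_mult: "Fract (x * y) 1 = Fract x 1 * Fract y 1"
  by simp_all

lemma to_K_0 [simp]: "to_K 0 = 0"
  by (simp add: to_K_def zero_z2_phi_def zero_q2_sqrt5_def flip: Zero_fract_def)

lemma to_K_1 [simp]: "to_K 1 = 1"
  by (simp add: to_K_def one_z2_phi_def one_q2_sqrt5_def flip: Zero_fract_def One_fract_def)

lemma to_K_add: "to_K (x + y) = to_K x + to_K y"
  by (simp only: to_K_def plus_z2_phi_def plus_q2_sqrt5_def z2_phi.sel q2_sqrt5.sel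
      Fract_one_add q2_sqrt5.inject add_divide_distrib add_ac simp_thms)

lemma to_K_mult: "to_K (x * y) = to_K x * to_K y"
proof -
  have "(a + b / 2) * (c + e / 2) + 5 * (b / 2 * (e / 2)) = (a * c + b * e) + (a * e + b * c + b * e) / 2"
    "(a + b / 2) * (e / 2) + b / 2 * (c + e / 2) = (a * e + b * c + b * e) / 2"
    for a b c e :: q2
  proof -
    \<comment> \<open>Writing \<open>b\<close> and \<open>e\<close> as doubles turns both equations
      into identities without fractions.\<close>
    obtain b' e' where be: "b = 2 * b'" "e = 2 * e'"
      using q2_two_neq_0 by (metis nonzero_mult_div_cancel_left times_divide_eq_right)
    have half: "2 * x / 2 = x" for x :: q2 using q2_two_neq_0 by simp
    have "a * (2 * e') + 2 * b' * c + 2 * b' * (2 * e') = 2 * (a * e' + b' * c + 2 * (b' * e'))"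
      by (simp add: algebra_simps)
    then have *: "(a * (2 * e') + 2 * b' * c + 2 * b' * (2 * e')) / 2 = a * e' + b' * c + 2 * (b' * e')"
      by (simp only: half)
    show "(a + b / 2) * (c + e / 2) + 5 * (b / 2 * (e / 2)) = (a * c + b * e) + (a * e + b * c + b * e) / 2"
      "(a + b / 2) * (e / 2) + b / 2 * (c + e / 2) = (a * e + b * c + b * e) / 2"
      unfolding be * half by (simp_all add: algebra_simps)
  qed
  then show ?thesis
    by (simp only: to_K_def times_z2_phi_def times_q2_sqrt5_def z2_phi.sel q2_sqrt5.sel
      Fract_one_add Fract_one_mult q2_sqrt5.inject)
qed

lemma to_K_power: "to_K (x ^ n) = to_K x ^ n"
  by (induction n) (simp_all add: to_K_mult)

lemma to_K_sum: "to_K (sum f A) = (\<Sum>i\<in>A. to_K (f i))"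
  by (induction A rule: infinite_finite_induct) (simp_all add: to_K_add)

lemma to_K_2: "to_K 2 = 2"
  using to_K_add[of 1 1] by simp

lemma to_K_eq_0_iff [simp]: "to_K x = 0 \<longleftrightarrow> x = 0"
proof
  assume "to_K x = 0"
  then have "Fract (phi_part x) 1 = 0" "Fract (const_part x) 1 = 0"
    using q2_two_neq_0 by (auto simp: to_K_def zero_q2_sqrt5_def)
  then have "Fract (phi_part x) 1 = Fract 0 1" "Fract (const_part x) 1 = Fract 0 1"
    by (simp_all only: Zero_fract_def)
  then have "phi_part x = 0" "const_part x = 0"
    by (simp_all add: eq_fract(1) del: fract_collapse)
  then show "x = 0"
    by (simp add: z2_phi.expand zero_z2_phi_def)
qed simp

text \<open>The embedding is injective, so zero divisors would survive in the field
  \<open>K\<close>.\<close>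

instance z2_phi :: idom
proof
  fix a b :: z2_phi
  assume "a \<noteq> 0" "b \<noteq> 0"
  then have "to_K (a * b) \<noteq> 0" by (simp add: to_K_mult)
  then show "a * b \<noteq> 0" by auto
qed

lemma z2_phi_two_neq_0 [simp]: "(2 :: z2_phi) \<noteq> 0"
proof
  assume "(2 :: z2_phi) = 0"
  then have "const_part (1 + 1) = const_part 0" by simp
  then show False using z2_two_neq_0 by (simp add: z2_phi_ring_defs)
qed

section \<open>Divisibility and completeness in \<open>\<int>\<^sub>2[\<phi>]\<close>\<close>

lemma z2_phi_power2_times: "2 ^ n * x = Z2_phi (2 ^ n * const_part x) (2 ^ n * phi_part x)"
proof (induction n)
  case (Suc n)
  have "2 ^ Suc n * x = (2 ^ n * x) + (2 ^ n * x)" by simp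
  then show ?case by (simp only: Suc) (simp add: plus_z2_phi_def)
qed simp

lemma z2_phi_power2_dvd_iff:
  "2 ^ n dvd (x :: z2_phi) \<longleftrightarrow> 2 ^ n dvd const_part x \<and> 2 ^ n dvd phi_part x"
proof
  show "2 ^ n dvd x \<Longrightarrow> 2 ^ n dvd const_part x \<and> 2 ^ n dvd phi_part x"
    by (auto simp: dvd_def z2_phi_power2_times)
  assume "2 ^ n dvd const_part x \<and> 2 ^ n dvd phi_part x"
  then obtain u v where "const_part x = 2 ^ n * u" "phi_part x = 2 ^ n * v" by (auto simp: dvd_def)
  then have "x = 2 ^ n * Z2_phi u v"
    by (intro z2_phi_eqI) (simp_all add: z2_phi_power2_times)
  then show "2 ^ n dvd x" by simp
qed

lemma z2_phi_even_iff: "2 dvd (x :: z2_phi) \<longleftrightarrow> 2 dvd const_part x \<and> 2 dvd phi_part x"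
  using z2_phi_power2_dvd_iff[of 1 x] by simp

lemma z2_phi_odd_one: "\<not> 2 dvd (1 :: z2_phi)"
  by (simp add: z2_phi_even_iff one_z2_phi_def z2_odd_one)

lemma power2_dvd_all_imp_0:
  assumes "\<And>n. 2 ^ n dvd (x :: z2_phi)"
  shows "x = 0"
  using assms
  by (auto simp: z2_phi_power2_dvd_iff z2_power2_dvd_iff z2_eq_0_iff zero_z2_phi_def
      intro!: z2_phi_eqI)

lemma z2_phi_complete:
  fixes X :: "nat \<Rightarrow> z2_phi"
  assumes "\<And>n. 2 ^ n dvd X (Suc n) - X n"
  obtains L where "\<And>n. 2 ^ n dvd L - X n"
proof -
  have "2 ^ n dvd const_part (X (Suc n)) - const_part (X n)" for n
    using assms[of n] by (simp add: z2_phi_power2_dvd_iff minus_z2_phi_def)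
  then obtain L1 where L1: "\<And>n. 2 ^ n dvd L1 - const_part (X n)"
    using z2_complete[of "\<lambda>n. const_part (X n)"] by blast
  have "2 ^ n dvd phi_part (X (Suc n)) - phi_part (X n)" for n
    using assms[of n] by (simp add: z2_phi_power2_dvd_iff minus_z2_phi_def)
  then obtain L2 where L2: "\<And>n. 2 ^ n dvd L2 - phi_part (X n)"
    using z2_complete[of "\<lambda>n. phi_part (X n)"] by blast
  show ?thesis
    using L1 L2
    by (intro that[of "Z2_phi L1 L2"]) (simp add: z2_phi_power2_dvd_iff minus_z2_phi_def)
qed

text \<open>The quotient by 2 is the field with four elements, whose units are 1,
  \<open>1 + \<phi>\<close> and \<open>\<phi>\<close>; one of them inverts \<open>a\<close>.\<close>

lemma z2_phi_unit_mod_2: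
  assumes "\<not> 2 dvd (a :: z2_phi)"
  obtains v where "2 dvd v * a - 1"
proof -
  have sub: "2 dvd x - y \<longleftrightarrow> (2 dvd x \<longleftrightarrow> 2 dvd y)" for x y :: z2
    using z2_even_add_iff[of "x - y" y] by auto
  have "2 dvd 1 * a - 1 \<or> 2 dvd Z2_phi 1 1 * a - 1 \<or> 2 dvd Z2_phi 0 1 * a - 1"
    unfolding z2_phi_even_iff
    by (simp only: minus_z2_phi_def one_z2_phi_def times_z2_phi_def z2_phi.sel sub
        z2_even_add_iff mult_1 mult_zero_left add_0 add_0_right z2_odd_one dvd_0_right simp_thms)
      (use assms z2_phi_even_iff[of a] in blast)
  then show ?thesis using that by blast
qed

text \<open>Taylor expansion to first order with an exact quadratic remainder, which gives the error
  term of the Hensel iteration.\<close>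

lemma power_add_expand:
  fixes X y :: "'a :: comm_ring_1"
  shows "\<exists>q. (X + y) ^ Suc n = X ^ Suc n + of_nat (Suc n) * y * X ^ n + y\<^sup>2 * q"
proof (induction n)
  case 0
  show ?case by (rule exI[of _ 0]) simp
next
  case (Suc n)
  then obtain q where q: "(X + y) ^ Suc n = X ^ Suc n + of_nat (Suc n) * y * X ^ n + y\<^sup>2 * q" by blast
  have "(X + y) ^ Suc (Suc n) = (X + y) * (X ^ Suc n + of_nat (Suc n) * y * X ^ n + y\<^sup>2 * q)"
    by (simp only: power_Suc[of _ "Suc n"] q)
  also have "\<dots> = X ^ Suc (Suc n) + of_nat (Suc (Suc n)) * y * X ^ Suc n
      + y\<^sup>2 * (of_nat (Suc n) * X ^ n + (X + y) * q)"
    by (simp add: algebra_simps power2_eq_square)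
  finally show ?case by blast
qed

lemma odd_cong_mult:
  fixes x y :: "'a :: comm_ring_1"
  assumes "2 dvd x - 1" "2 dvd y - 1"
  shows "2 dvd x * y - 1"
proof -
  have "x * y - 1 = x * (y - 1) + (x - 1)" by (simp add: algebra_simps)
  then show ?thesis using assms by (metis dvd_add dvd_mult)
qed

lemma odd_cong_power:
  fixes x :: "'a :: comm_ring_1"
  assumes "2 dvd x - 1"
  shows "2 dvd x ^ n - 1"
  by (induction n) (use assms odd_cong_mult in auto)

lemma diff_dvd_power_diff:
  fixes x y :: "'a :: comm_ring_1"
  shows "x - y dvd x ^ n - y ^ n"
  by (metis dvd_triv_left power_diff_sumr2)

text \<open>The root is the limit of the iteration \<open>X \<mapsto> X + v (c - a X\<^sup>d) / 2\<close> with \<open>v a \<equiv> 1\<close> modulo 2,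
  a variant of Newton's method that needs no division by the derivative.\<close>

lemma hensel:
  fixes a c :: z2_phi
  assumes d: "d = 2 * m" "odd m" and a: "\<not> 2 dvd a"
    and X0: "2 dvd X0 - 1" "8 dvd c - a * X0 ^ d"
  obtains X where "2 dvd X - 1" "a * X ^ d = c"
proof -
  obtain v where v: "2 dvd v * a - 1" using a by (rule z2_phi_unit_mod_2)
  have "d \<noteq> 0" using d by (auto elim: oddE)
  then obtain d' where d': "d = Suc d'" using not0_implies_Suc by blast
  have m: "2 dvd of_nat m - (1 :: z2_phi)"
  proof -
    obtain k where "m = 2 * k + 1" using d(2) by (rule oddE)
    then show ?thesis by simp
  qed
  have step: "\<exists>Y. (2 dvd Y - 1 \<and> 2 ^ (Suc n + 3) dvd c - a * Y ^ d) \<and> 2 ^ n dvd Y - X"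
    if X: "2 dvd X - 1" "2 ^ (n + 3) dvd c - a * X ^ d" for X n
  proof -
    obtain t where t: "c - a * X ^ d = 2 ^ (n + 3) * t" using X by blast
    \<comment> \<open>Half of the present error. Starting modulo 8 makes \<open>e\<close> a multiple
      of \<open>2 ^ (n + 2)\<close>, so both \<open>4 * e\<close> and \<open>e\<^sup>2\<close> are
      divisible by \<open>2 ^ (n + 4)\<close>: one digit is gained.\<close>
    define e where "e = 2 ^ (n + 2) * t"
    have ce: "c - a * X ^ d = 2 * e" by (simp add: t e_def power_add)
    obtain q where "(X + v * e) ^ Suc d' = X ^ Suc d' + of_nat (Suc d') * (v * e) * X ^ d' + (v * e)\<^sup>2 * q"
      using power_add_expand by blast
    then have q: "(X + v * e) ^ d = X ^ d + of_nat d * (v * e) * X ^ d' + (v * e)\<^sup>2 * q"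
      by (simp only: d')
    \<comment> \<open>As \<open>d\<close> is twice an odd number, the linear term of the expansion
      is \<open>2 * e\<close> times this product; being 1 modulo 2, it cancels the error
      \<open>2 * e\<close> up to a multiple of \<open>4 * e\<close>.\<close>
    have "2 dvd of_nat m * (v * a) * X ^ d' - 1"
      by (intro odd_cong_mult odd_cong_power m v X)
    then obtain z where z: "of_nat m * (v * a) * X ^ d' - 1 = 2 * z" by blast
    have "c - a * (X + v * e) ^ d = 2 * e - a * of_nat d * (v * e) * X ^ d' - a * (v * e)\<^sup>2 * q"
      using ce unfolding q by (simp add: algebra_simps)
    also have "\<dots> = - (2 * e * (of_nat m * (v * a) * X ^ d' - 1)) - e\<^sup>2 * (a * v\<^sup>2 * q)"
      by (simp add: d(1) algebra_simps power2_eq_square)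
    also have "\<dots> = - (4 * e * z) - e\<^sup>2 * (a * v\<^sup>2 * q)"
      unfolding z by simp
    also have "\<dots> = 2 ^ (Suc n + 3) * (- (t * z) - 2 ^ n * (t\<^sup>2 * (a * v\<^sup>2 * q)))"
      by (simp add: e_def power_add algebra_simps power2_eq_square)
    finally have "2 ^ (Suc n + 3) dvd c - a * (X + v * e) ^ d" by simp
    moreover have "2 dvd X + v * e - 1"
    proof -
      have "X + v * e - 1 = (X - 1) + 2 * (2 ^ (n + 1) * (v * t))" by (simp add: e_def algebra_simps)
      then show ?thesis using X(1) by (metis dvd_add dvd_triv_left)
    qed
    moreover have "2 ^ n dvd X + v * e - X" by (simp add: e_def power_add)
    ultimately show ?thesis by blast
  qed
  have "\<exists>f. \<forall>n. (2 dvd f n - 1 \<and> 2 ^ (n + 3) dvd c - a * f n ^ d) \<and> 2 ^ n dvd f (Suc n) - f n"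
    by (rule dependent_nat_choice[where P = "\<lambda>n X. 2 dvd X - 1 \<and> 2 ^ (n + 3) dvd c - a * X ^ d" and
          Q = "\<lambda>n X Y. 2 ^ n dvd Y - X"])
      (use X0 step in auto)
  then obtain f where f: "\<And>n. 2 dvd f n - 1" "\<And>n. 2 ^ (n + 3) dvd c - a * f n ^ d"
    "\<And>n. 2 ^ n dvd f (Suc n) - f n" by blast
  obtain L where L: "\<And>n. 2 ^ n dvd L - f n" using f(3) z2_phi_complete[of f] by blast
  have "2 dvd L - 1"
  proof -
    have "L - 1 = (L - f 1) + (f 1 - 1)" by simp
    then show ?thesis using L[of 1] f(1)[of 1] by (metis dvd_add power_one_right)
  qed
  moreover have "2 ^ n dvd c - a * L ^ d" for n
  proof -
    have "2 ^ n dvd L ^ d - f n ^ d" using L[of n] diff_dvd_power_diff dvd_trans by blast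
    moreover have "2 ^ n dvd c - a * f n ^ d"
      using f(2)[of n] by (rule power_le_dvd) simp
    moreover have "c - a * L ^ d = (c - a * f n ^ d) - a * (L ^ d - f n ^ d)"
      by (simp add: algebra_simps)
    ultimately show ?thesis by (metis dvd_diff dvd_mult)
  qed
  then have "c - a * L ^ d = 0" by (rule power2_dvd_all_imp_0)
  ultimately show ?thesis using that by auto
qed

section \<open>Normal form of the coefficients up to \<open>d\<close>-th powers\<close>

lemma z2_phi_normal_form:
  assumes "(r :: z2_phi) \<noteq> 0"
  obtains n u where "r = 2 ^ n * u" "\<not> 2 dvd u"
proof -
  obtain N where N: "\<not> 2 ^ N dvd r" using assms power2_dvd_all_imp_0 by blast
  define n where "n = (LEAST n. \<not> 2 ^ Suc n dvd r)"
  have ex: "\<not> 2 ^ Suc N dvd r" using N by (meson dvd_trans le_imp_power_dvd le_SucI order_refl)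
  have n: "\<not> 2 ^ Suc n dvd r" unfolding n_def by (rule LeastI[of "\<lambda>n. \<not> 2 ^ Suc n dvd r", OF ex])
  have "2 ^ n dvd r"
  proof (cases n)
    case (Suc k)
    then show ?thesis using not_less_Least[of k "\<lambda>n. \<not> 2 ^ Suc n dvd r"] by (simp add: n_def)
  qed simp
  then obtain u where "r = 2 ^ n * u" by blast
  moreover have "\<not> 2 dvd u" using n by (auto simp: calculation)
  ultimately show ?thesis by (rule that)
qed

text \<open>A coefficient matters only up to \<open>d\<close>-th powers: \<open>B\<close> clears the
  denominators of both coordinates, and \<open>P\<close> reduces the exponent of 2 modulo
  \<open>d\<close>.\<close>

lemma K_normal_form:
  fixes k :: q2_sqrt5
  assumes "k \<noteq> 0" "d > 0"
  obtains c i u where "c \<noteq> 0" "i < d" "\<not> 2 dvd u" "k * c ^ d = 2 ^ i * to_K u"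
proof -
  obtain p b where p: "rat_part k = Fract p b" "b \<noteq> 0" by (cases "rat_part k") auto
  obtain q e where q: "sqrt_part k = Fract q e" "e \<noteq> 0" by (cases "sqrt_part k") auto
  define B where "B = Z2_phi (b * e) 0"
  have [simp]: "Fract (2 * x) 1 / 2 = Fract x 1" for x :: z2
    using q2_two_neq_0 by (simp add: Fract_one_mult Fract_numeral_one[symmetric] del: mult_fract)
  have "B \<noteq> 0" using p q by (simp add: B_def zero_z2_phi_def)
  have "to_K B = Q2_sqrt5 (Fract (b * e) 1) 0"
    by (simp add: to_K_def B_def fract_collapse(1))
  moreover have "Fract p b * Fract (b * e) 1 = Fract (p * e) 1" "Fract q e * Fract (b * e) 1 = Fract (q * b) 1"
    using p q by (simp_all add: eq_fract(1))
  ultimately have "k * to_K B = Q2_sqrt5 (Fract (p * e) 1) (Fract (q * b) 1)"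
    by (simp only: times_q2_sqrt5_def q2_sqrt5.sel p q mult_zero_right add_0_right add_0)
  \<comment> \<open>Here \<open>\<surd>5 = 2 \<phi> - 1\<close> is substituted.\<close>
  also have "\<dots> = to_K (Z2_phi (p * e - q * b) (2 * (q * b)))"
    by (simp add: to_K_def flip: Fract_one_add)
  finally have "k * to_K B = to_K (Z2_phi (p * e - q * b) (2 * (q * b)))" .
  then obtain r where r: "k * to_K B = to_K r" by blast
  obtain d' where d': "d = Suc d'" using assms(2) by (cases d) auto
  have kB: "k * to_K B ^ d = to_K (r * B ^ d')"
    by (simp add: d' to_K_mult to_K_power flip: r)
  have "r * B ^ d' \<noteq> 0"
    using \<open>B \<noteq> 0\<close> assms(1) r by (metis kB no_zero_divisors power_not_zero to_K_eq_0_iff)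
  then obtain n u where n: "r * B ^ d' = 2 ^ n * u" "\<not> 2 dvd u" by (rule z2_phi_normal_form)
  have K2: "(2 :: q2_sqrt5) \<noteq> 0" using to_K_eq_0_iff[of 2] by (simp add: to_K_2)
  define P :: q2_sqrt5 where "P = 2 ^ (n div d)"
  have P: "(2 :: q2_sqrt5) ^ n = 2 ^ (n mod d) * P ^ d"
    unfolding P_def by (metis mult.commute mult_div_mod_eq power_add power_mult)
  have "P \<noteq> 0" using K2 by (simp add: P_def)
  have "k * (to_K B / P) ^ d = to_K (r * B ^ d') / P ^ d"
    by (simp only: power_divide times_divide_eq_right kB)
  also have "\<dots> = 2 ^ (n mod d) * to_K u"
    using \<open>P \<noteq> 0\<close> by (simp add: n(1) to_K_mult to_K_power to_K_2 P)
  finally have "k * (to_K B / P) ^ d = 2 ^ (n mod d) * to_K u" .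
  then show ?thesis
    using that[of "to_K B / P" "n mod d" u] \<open>B \<noteq> 0\<close> \<open>P \<noteq> 0\<close> n(2) assms(2) by simp
qed

section \<open>Zero-sum subsets\<close>

text \<open>For a subgroup \<open>K\<close> of \<open>L\<close> this says that \<open>L / K\<close>
  is an elementary abelian 2-group of order at most 4: any three vectors over the field with two
  elements are dependent. Stating it through subset sums avoids quotient groups.\<close>

definition index4 :: "'a :: ab_group_add set \<Rightarrow> 'a set \<Rightarrow> bool" where
  "index4 L K \<longleftrightarrow>
    (\<forall>x\<in>L. \<forall>y\<in>L. \<forall>z\<in>L. x \<in> K \<or> y \<in> K \<or> z \<in> K \<or> x + y \<in> K \<or> x + z \<in> K \<or> y + z \<in> K \<or> x + y + z \<in> K) \<and>
    (\<forall>x\<in>L. x + x \<in> K) \<and> (\<forall>x\<in>K. \<forall>y\<in>K. x + y \<in> K \<and> x - y \<in> K)"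

definition index2 :: "'a :: ab_group_add set \<Rightarrow> 'a set \<Rightarrow> bool" where
  "index2 K M \<longleftrightarrow> (\<forall>x\<in>K. \<forall>y\<in>K. x \<in> M \<or> y \<in> M \<or> x + y \<in> M)"

lemma obtain_two:
  assumes "2 \<le> card A"
  obtains x y where "x \<in> A" "y \<in> A" "x \<noteq> y"
proof -
  obtain T where "T \<subseteq> A" "card T = 2" using assms by (meson obtain_subset_with_card_n)
  then show ?thesis using that by (auto simp: card_2_iff)
qed

lemma obtain_three:
  assumes "3 \<le> card A"
  obtains x y z where "x \<in> A" "y \<in> A" "z \<in> A" "x \<noteq> y" "x \<noteq> z" "y \<noteq> z"
proof -
  obtain T where "T \<subseteq> A" "card T = 3" using assms by (meson obtain_subset_with_card_n)
  then show ?thesis using that by (auto simp: card_3_iff)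
qed

lemma zero_sum_of_3:
  assumes "3 \<le> card I" "\<And>i. i \<in> I \<Longrightarrow> h i \<in> L" "index4 L K"
  obtains S where "S \<subseteq> I" "S \<noteq> {}" "sum h S \<in> K"
proof -
  obtain x y z where xyz: "x \<in> I" "y \<in> I" "z \<in> I" "x \<noteq> y" "x \<noteq> z" "y \<noteq> z"
    using assms(1) by (rule obtain_three)
  have "h x \<in> K \<or> h y \<in> K \<or> h z \<in> K \<or> h x + h y \<in> K \<or> h x + h z \<in> K \<or> h y + h z \<in> K
    \<or> h x + h y + h z \<in> K"
    using assms(2,3) xyz unfolding index4_def by blast
  then show ?thesis
    using that[of "{x}"] that[of "{y}"] that[of "{z}"] that[of "{x, y}"] that[of "{x, z}"]
      that[of "{y, z}"] that[of "{x, y, z}"] xyz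
    by (auto simp: add.assoc)
qed

text \<open>If the triples \<open>x, y, z\<close> and \<open>x, y, w\<close> both have sum in
  \<open>K\<close>, adding them shows that \<open>w, z\<close> does too. So a fourth element makes a
  sum of length at most 2 possible, which saves elements for further sums.\<close>

lemma zero_sum_of_4:
  assumes "4 \<le> card I" "\<And>i. i \<in> I \<Longrightarrow> h i \<in> L" "index4 L K"
  obtains S where "S \<subseteq> I" "S \<noteq> {}" "card S \<le> 2" "sum h S \<in> K"
proof -
  note thesisI = that
  have "I \<noteq> {}" using assms(1) by auto
  then obtain w where w: "w \<in> I" by blast
  have "3 \<le> card (I - {w})" using assms(1) w by (simp add: card_Diff_singleton)
  then obtain x y z where xyz: "x \<in> I" "y \<in> I" "z \<in> I" "x \<noteq> y" "x \<noteq> z" "y \<noteq> z" "w \<noteq> x" "w \<noteq> y" "w \<noteq> z"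
    by (rule obtain_three) auto
  have L: "h w \<in> L" "h x \<in> L" "h y \<in> L" "h z \<in> L" using w xyz assms(2) by auto
  have trip: "p \<in> K \<or> q \<in> K \<or> r \<in> K \<or> p + q \<in> K \<or> p + r \<in> K \<or> q + r \<in> K \<or> p + q + r \<in> K"
    if "p \<in> L" "q \<in> L" "r \<in> L" for p q r
    using assms(3) that unfolding index4_def by blast
  have "h w + h z \<in> K" if "h x + h y + h z \<in> K" "h x + h y + h w \<in> K"
  proof -
    have "(h x + h y + h z) + (h x + h y + h w) - ((h x + h x) + (h y + h y)) \<in> K"
      using assms(3) L that unfolding index4_def by blast
    then show ?thesis by (simp add: algebra_simps)
  qed
  then have "h w \<in> K \<or> h x \<in> K \<or> h y \<in> K \<or> h z \<in> K \<or> h w + h z \<in> K \<or> h x + h w \<in> K \<or> h y + h w \<in> K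
      \<or> h x + h y \<in> K \<or> h x + h z \<in> K \<or> h y + h z \<in> K"
    using trip[OF L(2,3,4)] trip[OF L(2,3,1)] by blast
  moreover have thesis if "h p \<in> K" "p \<in> I" for p
    using thesisI[of "{p}"] that by simp
  moreover have thesis if "h p + h q \<in> K" "p \<in> I" "q \<in> I" "p \<noteq> q" for p q
    using thesisI[of "{p, q}"] that by simp
  ultimately show ?thesis using w xyz by blast
qed

text \<open>The first sum uses at most two elements, and the remaining three give the
  second.\<close>

lemma two_zero_sums_of_5:
  assumes "5 \<le> card I" "\<And>i. i \<in> I \<Longrightarrow> h i \<in> L" "index4 L K"
  obtains S T where "S \<subseteq> I" "T \<subseteq> I" "S \<inter> T = {}" "S \<noteq> {}" "T \<noteq> {}" "card S \<le> 2" "sum h S \<in> K" "sum h T \<in> K"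
proof -
  have fin: "finite I" using assms(1) card.infinite by fastforce
  obtain S where S: "S \<subseteq> I" "S \<noteq> {}" "card S \<le> 2" "sum h S \<in> K"
    by (rule zero_sum_of_4[of I h L K]) (use assms in auto)
  have "3 \<le> card (I - S)"
    using assms(1) S fin by (simp add: card_Diff_subset finite_subset)
  then obtain T where "T \<subseteq> I - S" "T \<noteq> {}" "sum h T \<in> K"
    by (rule zero_sum_of_3[of "I - S" h L K]) (use assms in auto)
  then show ?thesis using that S by blast
qed

text \<open>Inductive method along the chain \<open>L\<close>, \<open>K\<close>, \<open>M\<close>:
  two disjoint subsums in \<open>K\<close> act as two elements of a group of order 2.\<close>

lemma davenport_5:
  assumes "5 \<le> card I" "\<And>i. i \<in> I \<Longrightarrow> h i \<in> L" "index4 L K" "index2 K M"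
  obtains S where "S \<subseteq> I" "S \<noteq> {}" "sum h S \<in> M"
proof -
  have fin: "finite I" using assms(1) card.infinite by fastforce
  obtain S T where ST: "S \<subseteq> I" "T \<subseteq> I" "S \<inter> T = {}" "S \<noteq> {}" "T \<noteq> {}" "sum h S \<in> K" "sum h T \<in> K"
    by (rule two_zero_sums_of_5[of I h L K]) (use assms in auto)
  have "sum h (S \<union> T) = sum h S + sum h T"
    using ST fin by (intro sum.union_disjoint) (auto intro: finite_subset)
  moreover have "sum h S \<in> M \<or> sum h T \<in> M \<or> sum h S + sum h T \<in> M"
    using assms(4) ST unfolding index2_def by blast
  ultimately show ?thesis
    using that[of S] that[of T] that[of "S \<union> T"] ST by auto
qed

text \<open>The same method with three disjoint subsums in \<open>K\<close>: a short one uses at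
  most two of the seven elements, and the other five give two more.\<close>

lemma davenport_7:
  assumes "7 \<le> card I" "\<And>i. i \<in> I \<Longrightarrow> h i \<in> L" "index4 L K" "index4 K M"
  obtains S where "S \<subseteq> I" "S \<noteq> {}" "sum h S \<in> M"
proof -
  have fin: "finite I" using assms(1) card.infinite by fastforce
  obtain S where S: "S \<subseteq> I" "S \<noteq> {}" "card S \<le> 2" "sum h S \<in> K"
    by (rule zero_sum_of_4[of I h L K]) (use assms in auto)
  have "5 \<le> card (I - S)"
    using assms(1) S fin by (simp add: card_Diff_subset finite_subset)
  then obtain T U where TU: "T \<subseteq> I - S" "U \<subseteq> I - S" "T \<inter> U = {}" "T \<noteq> {}" "U \<noteq> {}"
    "sum h T \<in> K" "sum h U \<in> K"
    by (rule two_zero_sums_of_5[of "I - S" h L K]) (use assms in auto)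
  have finS: "finite S" "finite T" "finite U" using S TU fin by (auto intro: finite_subset)
  have disj: "S \<inter> T = {}" "S \<inter> U = {}" using TU by auto
  have un: "sum h (S \<union> T) = sum h S + sum h T" "sum h (S \<union> U) = sum h S + sum h U"
    "sum h (T \<union> U) = sum h T + sum h U" "sum h (S \<union> T \<union> U) = sum h S + sum h T + sum h U"
    using finS S TU by (simp_all add: sum.union_disjoint Int_Un_distrib2 disj)
  have "sum h S \<in> M \<or> sum h T \<in> M \<or> sum h U \<in> M \<or> sum h S + sum h T \<in> M \<or> sum h S + sum h U \<in> M
      \<or> sum h T + sum h U \<in> M \<or> sum h S + sum h T + sum h U \<in> M"
    using assms(4) S TU unfolding index4_def by blast
  then show ?thesis
    using that[of S] that[of T] that[of U] that[of "S \<union> T"] that[of "S \<union> U"] that[of "T \<union> U"]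
      that[of "S \<union> T \<union> U"] S TU un by auto
qed

section \<open>Residue classes and lattices\<close>

lemma const_part_add: "const_part (x + y) = const_part x + const_part y"
  and phi_part_add: "phi_part (x + y) = phi_part x + phi_part y"
  by (simp_all add: plus_z2_phi_def)

lemmas parity_simps = z2_phi_even_iff const_part_add phi_part_add z2_even_add_iff

text \<open>The class of \<open>r\<close> modulo 2 lies in the additive subgroup {0,
  \<open>a\<close>} of the field with four elements; signs do not matter there.\<close>

definition near :: "z2_phi \<Rightarrow> z2_phi \<Rightarrow> bool" where
  "near a r \<longleftrightarrow> 2 dvd r \<or> 2 dvd r + a"

text \<open>For odd \<open>a\<close> the subgroup {0, \<open>a\<close>} has index 2, so nearness is
  a parity that adds up. The contradictions below are computations with this parity.\<close>

lemma near_add: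
  assumes "\<not> 2 dvd a"
  shows "near a (x + y) \<longleftrightarrow> (near a x \<longleftrightarrow> near a y)"
  using assms unfolding near_def parity_simps by blast

lemma near_self [simp]: "near a a" and near_even [simp]: "near a (2 * x)" and near_0 [simp]: "near a 0"
  by (simp_all add: near_def flip: mult_2)

lemma near_cong: "2 dvd a + b \<Longrightarrow> near a x \<longleftrightarrow> near b x"
  unfolding near_def parity_simps by blast

lemma even_uminus_add_iff: "2 dvd x - (y :: z2_phi) \<longleftrightarrow> 2 dvd x + y"
proof -
  have "x + y = (x - y) + 2 * y" by simp
  then show ?thesis by (metis dvd_add_left_iff dvd_triv_left)
qed

lemma near_of_int [simp]: "near a (of_int n * a)"
proof (cases "even n")
  case True
  then obtain k where "n = 2 * k" by blast
  then have "of_int n * a = 2 * (of_int k * a)" by simp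
  then show ?thesis by (simp only: near_even)
next
  case False
  then obtain k where "n = 2 * k + 1" by (rule oddE)
  then have "of_int n * a + a = 2 * (of_int k * a + a)" by (simp add: algebra_simps)
  then show ?thesis unfolding near_def by simp
qed

lemma near_cases:
  assumes "near a x"
  obtains (even) r where "x = 2 * r" | (odd) r where "x = - a + 2 * r"
  using assms unfolding near_def
proof (elim disjE dvdE)
  fix k assume "x + a = 2 * k"
  then have "x = - a + 2 * k" by (simp add: algebra_simps)
  then show ?thesis by (rule odd)
qed (use even in blast)

definition near_multiples :: "z2_phi \<Rightarrow> z2_phi \<Rightarrow> z2_phi set" where
  "near_multiples c a = {c * x | x. near a x}"

definition lat :: "z2_phi \<Rightarrow> nat \<Rightarrow> z2_phi set" where
  "lat a j = {of_int n * a + 2 ^ j * r | n r. True}"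

lemma latI: "x = of_int n * a + 2 ^ j * r \<Longrightarrow> x \<in> lat a j"
  by (auto simp: lat_def)

lemma near_multiplesI: "x = c * y \<Longrightarrow> near a y \<Longrightarrow> x \<in> near_multiples c a"
  by (auto simp: near_multiples_def)

lemma lat_add: "x \<in> lat a j \<Longrightarrow> y \<in> lat a j \<Longrightarrow> x + y \<in> lat a j"
  and lat_diff: "x \<in> lat a j \<Longrightarrow> y \<in> lat a j \<Longrightarrow> x - y \<in> lat a j"
proof -
  assume "x \<in> lat a j" "y \<in> lat a j"
  then obtain n r n' r' where *: "x = of_int n * a + 2 ^ j * r" "y = of_int n' * a + 2 ^ j * r'"
    by (auto simp: lat_def)
  show "x + y \<in> lat a j"
    by (rule latI[of _ "n + n'" _ _ "r + r'"]) (simp add: * algebra_simps)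
  show "x - y \<in> lat a j"
    by (rule latI[of _ "n - n'" _ _ "r - r'"]) (simp add: * algebra_simps)
qed

lemma index4_scale:
  fixes c :: "'a :: comm_ring_1"
  assumes "index4 L K"
  shows "index4 ((*) c ` L) ((*) c ` K)"
  unfolding index4_def
proof (intro conjI)
  show "\<forall>x\<in>(*) c ` L. \<forall>y\<in>(*) c ` L. \<forall>z\<in>(*) c ` L.
    x \<in> (*) c ` K \<or> y \<in> (*) c ` K \<or> z \<in> (*) c ` K \<or> x + y \<in> (*) c ` K \<or> x + z \<in> (*) c ` K \<or> y + z \<in> (*) c ` K
    \<or> x + y + z \<in> (*) c ` K"
  proof (intro ballI)
    fix x y z assume "x \<in> (*) c ` L" "y \<in> (*) c ` L" "z \<in> (*) c ` L"
    then obtain p q r where pqr: "p \<in> L" "q \<in> L" "r \<in> L" and xyz: "x = c * p" "y = c * q" "z = c * r"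
      by blast
    have "p \<in> K \<or> q \<in> K \<or> r \<in> K \<or> p + q \<in> K \<or> p + r \<in> K \<or> q + r \<in> K \<or> p + q + r \<in> K"
      using assms pqr unfolding index4_def by blast
    then show "x \<in> (*) c ` K \<or> y \<in> (*) c ` K \<or> z \<in> (*) c ` K \<or> x + y \<in> (*) c ` K
      \<or> x + z \<in> (*) c ` K \<or> y + z \<in> (*) c ` K \<or> x + y + z \<in> (*) c ` K"
      unfolding xyz distrib_left[symmetric] by blast
  qed
  show "\<forall>x\<in>(*) c ` L. x + x \<in> (*) c ` K"
  proof
    fix x assume "x \<in> (*) c ` L"
    then obtain p where "p \<in> L" "x = c * p" by blast
    then have "x + x = c * (p + p)" "p + p \<in> K"
      using assms unfolding index4_def by (simp_all only: distrib_left)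
    then show "x + x \<in> (*) c ` K" by blast
  qed
  show "\<forall>x\<in>(*) c ` K. \<forall>y\<in>(*) c ` K. x + y \<in> (*) c ` K \<and> x - y \<in> (*) c ` K"
  proof (intro ballI)
    fix x y assume "x \<in> (*) c ` K" "y \<in> (*) c ` K"
    then obtain p q where pq: "p \<in> K" "q \<in> K" and "x = c * p" "y = c * q" by blast
    then have "x + y = c * (p + q)" "x - y = c * (p - q)" by (simp_all only: distrib_left right_diff_distrib)
    moreover have "p + q \<in> K" "p - q \<in> K" using assms pq unfolding index4_def by blast+
    ultimately show "x + y \<in> (*) c ` K \<and> x - y \<in> (*) c ` K" by blast
  qed
qed

lemma index4_UNIV: "index4 UNIV ((*) (2 :: z2_phi) ` UNIV)"
proof -
  have ev: "x \<in> (*) 2 ` UNIV \<longleftrightarrow> 2 dvd x" for x :: z2_phi by (auto simp: dvd_def)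
  have "2 dvd x \<or> 2 dvd y \<or> 2 dvd z \<or> 2 dvd x + y \<or> 2 dvd x + z \<or> 2 dvd y + z \<or> 2 dvd x + y + z"
    for x y z :: z2_phi
    unfolding parity_simps by blast
  then show ?thesis
    unfolding index4_def ev by (simp flip: mult_2)
qed

text \<open>An element \<open>n a + 2 ^ (j + 1) r\<close> lies in the doubled lattice once
  \<open>n\<close> is even and \<open>r\<close> is near \<open>a\<close>. These are two additive
  parities, so three elements always have a subsum on which both vanish.\<close>

lemma index4_lat:
  assumes a: "\<not> 2 dvd a"
  shows "index4 (lat a (Suc j)) ((*) 2 ` lat a (Suc j))"
  unfolding index4_def
proof (intro conjI ballI)
  let ?K = "(*) 2 ` lat a (Suc j)"
  have K: "of_int n * a + 2 ^ Suc j * r \<in> ?K" if n: "even n" and r: "near a r" for n r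
  proof -
    obtain k where k: "n = 2 * k" using n by blast
    show ?thesis using r
    proof (cases rule: near_cases)
      case (even s)
      then have "of_int n * a + 2 ^ Suc j * r = 2 * (of_int k * a + 2 ^ Suc j * s)"
        by (simp add: k algebra_simps)
      then show ?thesis using latI by blast
    next
      case (odd s)
      \<comment> \<open>The part \<open>- a\<close> of \<open>r\<close> moves into the integer
        multiple of \<open>a\<close>, since \<open>2 ^ (j + 1) a\<close> is twice
        \<open>2 ^ j a\<close>.\<close>
      have "of_int n * a + 2 ^ Suc j * r = 2 * (of_int (k - 2 ^ j) * a + 2 ^ Suc j * s)"
        unfolding k odd by (simp add: algebra_simps)
      then show ?thesis using latI by blast
    qed
  qed
  fix x y z assume "x \<in> lat a (Suc j)" "y \<in> lat a (Suc j)" "z \<in> lat a (Suc j)"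
  then obtain n1 r1 n2 r2 n3 r3 where xyz: "x = of_int n1 * a + 2 ^ Suc j * r1"
    "y = of_int n2 * a + 2 ^ Suc j * r2" "z = of_int n3 * a + 2 ^ Suc j * r3"
    by (auto simp: lat_def)
  have sums: "x + y = of_int (n1 + n2) * a + 2 ^ Suc j * (r1 + r2)"
    "x + z = of_int (n1 + n3) * a + 2 ^ Suc j * (r1 + r3)"
    "y + z = of_int (n2 + n3) * a + 2 ^ Suc j * (r2 + r3)"
    "x + y + z = of_int (n1 + n2 + n3) * a + 2 ^ Suc j * (r1 + r2 + r3)"
    by (simp_all add: xyz algebra_simps)
  have "(even n1 \<and> near a r1) \<or> (even n2 \<and> near a r2) \<or> (even n3 \<and> near a r3)
    \<or> (even (n1 + n2) \<and> near a (r1 + r2)) \<or> (even (n1 + n3) \<and> near a (r1 + r3))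
    \<or> (even (n2 + n3) \<and> near a (r2 + r3)) \<or> (even (n1 + n2 + n3) \<and> near a (r1 + r2 + r3))"
    unfolding near_add[OF a] even_add by blast
  then show "x \<in> ?K \<or> y \<in> ?K \<or> z \<in> ?K \<or> x + y \<in> ?K \<or> x + z \<in> ?K \<or> y + z \<in> ?K \<or> x + y + z \<in> ?K"
    using K[of n1 r1, folded xyz(1)] K[of n2 r2, folded xyz(2)] K[of n3 r3, folded xyz(3)]
      K[of "n1 + n2" "r1 + r2", folded sums(1)] K[of "n1 + n3" "r1 + r3", folded sums(2)]
      K[of "n2 + n3" "r2 + r3", folded sums(3)] K[of "n1 + n2 + n3" "r1 + r2 + r3", folded sums(4)]
    by blast
next
  fix x assume "x \<in> lat a (Suc j)"
  then show "x + x \<in> (*) 2 ` lat a (Suc j)" by (simp only: image_eqI flip: mult_2)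
next
  fix x y assume "x \<in> (*) 2 ` lat a (Suc j)" "y \<in> (*) 2 ` lat a (Suc j)"
  then obtain p q where pq: "p \<in> lat a (Suc j)" "q \<in> lat a (Suc j)" and "x = 2 * p" "y = 2 * q" by blast
  then have "x + y = 2 * (p + q)" "x - y = 2 * (p - q)" by (simp_all only: distrib_left right_diff_distrib)
  then show "x + y \<in> (*) 2 ` lat a (Suc j)" "x - y \<in> (*) 2 ` lat a (Suc j)"
    using lat_add[OF pq] lat_diff[OF pq] by blast+
qed

text \<open>The admissible sums are 0 and \<open>2 b\<close> modulo 4. Dividing \<int>/4 \<times>
  \<int>/4 by an element of order 2 of this kind leaves \<int>/4 \<times> \<int>/2.\<close>

lemma half_sum_near:
  assumes "5 \<le> card J" "\<not> 2 dvd b"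
  obtains S u where "S \<subseteq> J" "S \<noteq> {}" "sum h S = 2 * u" "near b u"
proof -
  have i2: "index2 ((*) 2 ` UNIV) (near_multiples 2 b)"
    unfolding index2_def
  proof (intro ballI)
    fix x y assume "x \<in> (*) 2 ` (UNIV :: z2_phi set)" "y \<in> (*) 2 ` (UNIV :: z2_phi set)"
    then obtain p q where pq: "x = 2 * p" "y = 2 * q" by blast
    have "x + y = 2 * (p + q)" by (simp add: pq distrib_left)
    then show "x \<in> near_multiples 2 b \<or> y \<in> near_multiples 2 b \<or> x + y \<in> near_multiples 2 b"
      using near_add[OF assms(2), of p q] pq near_multiplesI by metis
  qed
  obtain S where "S \<subseteq> J" "S \<noteq> {}" "sum h S \<in> near_multiples 2 b"
    by (rule davenport_5[of J h, OF assms(1) _ index4_UNIV i2]) auto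
  then show ?thesis using that by (auto simp: near_multiples_def)
qed

text \<open>Modulo the elements \<open>4 z\<close> with \<open>z\<close> near \<open>a\<close>, the
  lattice \<open>lat a 2\<close> is \<int>/4 \<times> \<int>/2: \<open>a\<close> has order 4, and
  the complementary direction has order 2.\<close>

lemma quarter_sum_near:
  assumes "5 \<le> card J" "\<not> 2 dvd a" "\<And>i. i \<in> J \<Longrightarrow> h i \<in> lat a 2"
  obtains S z where "S \<subseteq> J" "S \<noteq> {}" "sum h S = 4 * z" "near a z"
proof -
  have M: "2 * (of_int n * a + 4 * r) \<in> near_multiples 4 a" if n: "even n" for n r
  proof -
    obtain k where "n = 2 * k" using n by blast
    then have "2 * (of_int n * a + 4 * r) = 4 * (of_int k * a + 2 * r)" by (simp add: algebra_simps)
    then show ?thesis by (rule near_multiplesI) (simp add: near_add[OF assms(2)])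
  qed
  have i2: "index2 ((*) 2 ` lat a 2) (near_multiples 4 a)"
    unfolding index2_def
  proof (intro ballI)
    fix x y assume "x \<in> (*) 2 ` lat a 2" "y \<in> (*) 2 ` lat a 2"
    then obtain n r n' r' where xy: "x = 2 * (of_int n * a + 4 * r)" "y = 2 * (of_int n' * a + 4 * r')"
      by (auto simp: lat_def)
    then have "x + y = 2 * (of_int (n + n') * a + 4 * (r + r'))" by (simp add: algebra_simps)
    then show "x \<in> near_multiples 4 a \<or> y \<in> near_multiples 4 a \<or> x + y \<in> near_multiples 4 a"
      using M[of n r] M[of n' r'] M[of "n + n'" "r + r'"] xy by (metis even_add)
  qed
  have i4: "index4 (lat a 2) ((*) 2 ` lat a 2)"
    using index4_lat[OF assms(2), of 1] by (simp add: numeral_2_eq_2)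
  obtain S where "S \<subseteq> J" "S \<noteq> {}" "sum h S \<in> near_multiples 4 a"
    by (rule davenport_5[OF assms(1) _ i4 i2, where h = h]) (use assms(3) in auto)
  then show ?thesis using that by (auto simp: near_multiples_def)
qed

text \<open>Coefficients near \<open>a\<close> lie in \<open>lat a 1\<close>, whose quotient by its
  fourfold is \<int>/4 \<times> \<int>/4.\<close>

lemma quarter_sum_near_7:
  assumes "7 \<le> card J" "\<not> 2 dvd a" "\<And>i. i \<in> J \<Longrightarrow> near a (h i)"
  obtains S z where "S \<subseteq> J" "S \<noteq> {}" "sum h S = 4 * z" "near a z"
proof -
  have "h i \<in> lat a 1" if "i \<in> J" for i
    using assms(3)[OF that]
  proof (cases rule: near_cases)
    case (even r)
    then show ?thesis by (intro latI[of _ 0 _ _ r]) simp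
  next
    case (odd r)
    then show ?thesis by (intro latI[of _ "- 1" _ _ r]) simp
  qed
  moreover have "index4 (lat a 1) ((*) 2 ` lat a 1)"
    using index4_lat[OF assms(2), of 0] by simp
  moreover from this have "index4 ((*) 2 ` lat a 1) ((*) 2 ` (*) 2 ` lat a 1)"
    by (rule index4_scale)
  ultimately obtain S where S: "S \<subseteq> J" "S \<noteq> {}" "sum h S \<in> (*) 2 ` (*) 2 ` lat a 1"
    using davenport_7[OF assms(1), of h "lat a 1"] by metis
  then obtain y where "sum h S = 2 * (2 * y)" "y \<in> lat a 1" by blast
  then obtain n r where "sum h S = 2 * (2 * (of_int n * a + 2 * r))"
    by (auto simp: lat_def)
  then have "sum h S = 4 * (of_int n * a + 2 * r)" by simp
  then show ?thesis by (rule that[OF S(1,2)]) (simp add: near_add[OF assms(2)])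
qed

section \<open>The form modulo 8\<close>

text \<open>\<open>S\<close> collects the variables with nonzero value, \<open>W\<close> those with value \<open>\<surd>5\<close>, whose \<open>d\<close>-th power is
  5 modulo 8; the other variables in \<open>S\<close> are 1.\<close>

definition solvable :: "'i set \<Rightarrow> 'i set \<Rightarrow> ('i \<Rightarrow> z2_phi) \<Rightarrow> bool" where
  "solvable I0 I1 c \<longleftrightarrow> (\<exists>S W. S \<subseteq> I0 \<union> I1 \<and> W \<subseteq> S \<inter> I0 \<and> S \<inter> I0 \<noteq> {} \<and> 8 dvd sum c S + 4 * sum c W)"

text \<open>If \<open>z\<close> is even, all variables in \<open>S\<close> may be 1; otherwise
  giving the value \<surd>5 to variable \<open>i\<close> adds \<open>4 * c i\<close> modulo 8, which
  repairs the sum.\<close>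

lemma solvable_near:
  assumes "S \<subseteq> I0 \<union> I1" "i \<in> S \<inter> I0" "sum c S = 4 * z" "near (c i) z"
  shows "solvable I0 I1 c"
  using assms(4)
proof (cases rule: near_cases)
  case (even r)
  then have "8 dvd sum c S + 4 * sum c {}" by (simp add: assms(3))
  then show ?thesis using assms(1,2) unfolding solvable_def by blast
next
  case (odd r)
  then have "sum c S + 4 * sum c {i} = 8 * r" unfolding assms(3) odd by (simp add: algebra_simps)
  then have "8 dvd sum c S + 4 * sum c {i}" by simp
  moreover have "{i} \<subseteq> S \<inter> I0" using assms(2) by blast
  ultimately show ?thesis using assms(1,2) unfolding solvable_def by blast
qed

text \<open>Two different nonzero classes span the field with four elements, so putting \<surd>5 at
  none, one or both of \<open>i\<close> and \<open>j\<close> repairs every \<open>z\<close>.\<close>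

lemma solvable_full:
  assumes "S \<subseteq> I0 \<union> I1" "i \<in> S \<inter> I0" "j \<in> S \<inter> I0" "sum c S = 4 * z"
    and "\<not> 2 dvd c i" "\<not> 2 dvd c j" "\<not> 2 dvd c i + c j"
  shows "solvable I0 I1 c"
proof (cases "near (c i) z \<or> near (c j) z")
  case True
  then show ?thesis
    using solvable_near[OF assms(1,2,4)] solvable_near[OF assms(1,3,4)] by blast
next
  case False
  moreover have "\<not> near (c i) (c j)" using assms(6,7) by (metis near_def add.commute)
  ultimately have "near (c i) (z + c j)" using near_add[OF assms(5)] by blast
  then have "2 dvd z + c j + c i" using False unfolding near_def by blast
  then obtain r where "z + c j + c i = 2 * r" by blast
  moreover have "4 * z + 4 * (c i + c j) = 4 * (z + c j + c i)" by (simp only: distrib_left add_ac)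
  ultimately have *: "4 * z + 4 * (c i + c j) = 8 * r" by simp
  have "i \<noteq> j" using assms(7) by (metis dvd_triv_left mult_2)
  then have "sum c {i, j} = c i + c j" by simp
  then have "sum c S + 4 * sum c {i, j} = 8 * r" by (simp only: assms(4) *)
  then have "8 dvd sum c S + 4 * sum c {i, j}" by simp
  moreover have "{i, j} \<subseteq> S \<inter> I0" using assms(2,3) by blast
  ultimately show ?thesis using assms(1,2) unfolding solvable_def by blast
qed

text \<open>Seven coefficients in {0, \<open>a\<close>} modulo 2 have a suitable subset sum. The
  last hypothesis keeps that subset from lying in \<open>B\<close>, so it contains a variable of the
  lowest level.\<close>

lemma solvable_one_class:
  assumes "A \<subseteq> I0" "B \<subseteq> I1" "I0 \<inter> I1 = {}" "finite A" "finite B" "7 \<le> card A + card B"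
    and "\<not> 2 dvd a" "\<And>i. i \<in> A \<Longrightarrow> 2 dvd c i + a" "\<And>i. i \<in> B \<Longrightarrow> 2 dvd c i"
    and "\<And>T. T \<subseteq> B \<Longrightarrow> T \<noteq> {} \<Longrightarrow> \<not> 4 dvd sum c T"
  shows "solvable I0 I1 c"
proof -
  have "card (A \<union> B) = card A + card B"
    using assms by (intro card_Un_disjoint) auto
  then have "7 \<le> card (A \<union> B)" using assms(6) by simp
  moreover have "near a (c i)" if "i \<in> A \<union> B" for i
    using that assms(8,9) unfolding near_def by blast
  ultimately obtain S z where S: "S \<subseteq> A \<union> B" "S \<noteq> {}" "sum c S = 4 * z" "near a z"
    using quarter_sum_near_7[of "A \<union> B" a c] assms(7) by metis
  have "\<not> S \<subseteq> B" using assms(10)[of S] S by auto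
  then obtain i where i: "i \<in> S" "i \<in> A" using S(1) by blast
  have "near (c i) z" using near_cong[OF assms(8)[OF i(2)]] S(4) by blast
  then show ?thesis
    using solvable_near[of S I0 I1 i c z] S i assms(1,2) by blast
qed

section \<open>Classes of odd coefficients modulo 2\<close>

definition same_class :: "('i \<Rightarrow> z2_phi) \<Rightarrow> 'i set \<Rightarrow> bool" where
  "same_class c A \<longleftrightarrow> (\<forall>i\<in>A. \<forall>j\<in>A. 2 dvd c i + c j)"

definition different_class :: "('i \<Rightarrow> z2_phi) \<Rightarrow> 'i set \<Rightarrow> 'i set \<Rightarrow> bool" where
  "different_class c A B \<longleftrightarrow> (\<forall>i\<in>A. \<forall>j\<in>B. \<not> 2 dvd c i + c j)"

text \<open>The sets belong to the three nonzero elements of the field with four elements, in any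
  order, and may be empty. Sums replace differences, which modulo 2 are the same.\<close>

definition classes :: "('i \<Rightarrow> z2_phi) \<Rightarrow> 'i set \<Rightarrow> 'i set \<Rightarrow> 'i set \<Rightarrow> bool" where
  "classes c A B C \<longleftrightarrow> finite A \<and> finite B \<and> finite C \<and>
    (\<forall>i\<in>A \<union> B \<union> C. \<not> 2 dvd c i) \<and> same_class c A \<and> same_class c B \<and> same_class c C \<and>
    different_class c A B \<and> different_class c A C \<and> different_class c B C"

lemma different_class_sym: "different_class c A B \<longleftrightarrow> different_class c B A"
  unfolding different_class_def by (metis add.commute)

lemma classes_swap: "classes c A B C \<Longrightarrow> classes c B A C" "classes c A B C \<Longrightarrow> classes c A C B"
  unfolding classes_def by (simp_all add: different_class_sym Un_ac)

lemma classes_disjoint: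
  assumes "classes c A B C"
  shows "A \<inter> B = {}" "A \<inter> C = {}" "B \<inter> C = {}"
proof -
  have "X \<inter> Y = {}" if "same_class c X" "different_class c X Y" for X Y
    using that unfolding same_class_def different_class_def by blast
  then show "A \<inter> B = {}" "A \<inter> C = {}" "B \<inter> C = {}" using assms unfolding classes_def by auto
qed

lemma classes_same:
  assumes "classes c A B C"
  shows "i \<in> A \<Longrightarrow> j \<in> A \<Longrightarrow> 2 dvd c i + c j" "i \<in> B \<Longrightarrow> j \<in> B \<Longrightarrow> 2 dvd c i + c j"
    "i \<in> C \<Longrightarrow> j \<in> C \<Longrightarrow> 2 dvd c i + c j"
  using assms unfolding classes_def same_class_def by simp_all

lemma classes_different:
  assumes "classes c A B C"
  shows "i \<in> A \<Longrightarrow> j \<in> B \<Longrightarrow> \<not> 2 dvd c i + c j" "i \<in> A \<Longrightarrow> j \<in> C \<Longrightarrow> \<not> 2 dvd c i + c j"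
    "i \<in> B \<Longrightarrow> j \<in> C \<Longrightarrow> \<not> 2 dvd c i + c j"
  using assms unfolding classes_def different_class_def by simp_all

text \<open>The parities of the two coordinates separate the residues 1, \<phi> and
  \<open>1 + \<phi>\<close>; the symmetry of \<open>classes\<close> permits sorting by size.\<close>

lemma obtain_classes:
  assumes "finite I" "\<And>i. i \<in> I \<Longrightarrow> \<not> 2 dvd c i"
  obtains A B C where "I = A \<union> B \<union> C" "classes c A B C" "card B \<le> card A" "card C \<le> card B"
    "card I = card A + card B + card C"
proof -
  define X where "X = {i\<in>I. 2 dvd phi_part (c i)}"
  define Y where "Y = {i\<in>I. 2 dvd const_part (c i)}"
  define Z where "Z = {i\<in>I. \<not> 2 dvd phi_part (c i) \<and> \<not> 2 dvd const_part (c i)}"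
  have XYZ: "classes c X Y Z" "I = X \<union> Y \<union> Z"
    using assms unfolding classes_def same_class_def different_class_def X_def Y_def Z_def parity_simps
    by auto
  have "\<exists>A B C. classes c A B C \<and> I = A \<union> B \<union> C \<and> card B \<le> card A \<and> card C \<le> card B"
  proof -
    have ex: ?thesis if "classes c P Q R" "P \<union> Q \<union> R = X \<union> Y \<union> Z" "card Q \<le> card P" "card R \<le> card Q" for P Q R
      using that XYZ(2) by metis
    note swap = classes_swap[of c]
    consider "card Y \<le> card X" "card Z \<le> card Y" | "card X \<le> card Y" "card Z \<le> card X"
      | "card Z \<le> card X" "card Y \<le> card Z" | "card X \<le> card Z" "card Y \<le> card X"
      | "card Z \<le> card Y" "card X \<le> card Z" | "card Y \<le> card Z" "card X \<le> card Y"
      by linarith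
    then show ?thesis
    proof cases
      case 1 then show ?thesis by (intro ex[OF XYZ(1)]) auto
    next
      case 2 then show ?thesis by (intro ex[OF swap(1)[OF XYZ(1)]]) auto
    next
      case 3 then show ?thesis by (intro ex[OF swap(2)[OF XYZ(1)]]) auto
    next
      case 4 then show ?thesis by (intro ex[OF swap(1)[OF swap(2)[OF XYZ(1)]]]) auto
    next
      case 5 then show ?thesis by (intro ex[OF swap(2)[OF swap(1)[OF XYZ(1)]]]) auto
    next
      case 6 then show ?thesis by (intro ex[OF swap(1)[OF swap(2)[OF swap(1)[OF XYZ(1)]]]]) auto
    qed
  qed
  then obtain A B C where ABC: "classes c A B C" "I = A \<union> B \<union> C" "card B \<le> card A" "card C \<le> card B" by blast
  have "card I = card A + card B + card C"
    using ABC(1) classes_disjoint[OF ABC(1)] unfolding ABC(2)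
    by (simp add: classes_def card_Un_disjoint Int_Un_distrib2)
  then show ?thesis using that ABC by blast
qed

text \<open>The three nonzero elements of the field with four elements sum to zero.\<close>

lemma even_triple:
  assumes "classes c A B C" "i \<in> A" "j \<in> B" "k \<in> C"
  shows "2 dvd c i + c j + c k"
proof -
  have "\<not> 2 dvd c i" "\<not> 2 dvd c j" "\<not> 2 dvd c k" "\<not> 2 dvd c i + c j" "\<not> 2 dvd c i + c k" "\<not> 2 dvd c j + c k"
    using assms classes_different[OF assms(1)] unfolding classes_def by auto
  then show ?thesis unfolding parity_simps by blast
qed

text \<open>Two elements of \<open>A'\<close> and two of another class, or one of each class, will
  do. Meeting two classes prepares \<open>solvable_full\<close>; the subset \<open>A'\<close> allows
  some elements of \<open>A\<close> to be held back.\<close>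

lemma full_even_subset:
  assumes cl: "classes c A B C" and A': "A' \<subseteq> A" "2 \<le> card A'" and BC: "2 \<le> card B + card C"
  obtains S i j where "S \<subseteq> A' \<union> B \<union> C" "i \<in> S" "j \<in> S" "\<not> 2 dvd c i + c j" "2 dvd sum c S"
proof -
  note thesisI = that
  have pair: thesis if B': "B' = B \<or> B' = C" and "2 \<le> card B'" for B'
  proof -
    obtain i j where ij: "i \<in> A'" "j \<in> A'" "i \<noteq> j" using A'(2) by (rule obtain_two)
    obtain k l where kl: "k \<in> B'" "l \<in> B'" "k \<noteq> l" using \<open>2 \<le> card B'\<close> by (rule obtain_two)
    have dist: "i \<noteq> k" "i \<noteq> l" "j \<noteq> k" "j \<noteq> l"
      using ij kl B' A'(1) classes_disjoint[OF cl] by auto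
    have iA: "i \<in> A" "j \<in> A" using ij A'(1) by auto
    have ev: "2 dvd c i + c j" "2 dvd c k + c l" "\<not> 2 dvd c i + c k"
      using classes_same(1)[OF cl iA] classes_same(2,3)[OF cl, of k l]
        classes_different(1,2)[OF cl iA(1), of k] kl B' by auto
    have "sum c {i, j, k, l} = (c i + c j) + (c k + c l)"
      using ij kl dist by (simp add: add.assoc)
    then have "2 dvd sum c {i, j, k, l}" using ev by (metis dvd_add)
    then show ?thesis
      using thesisI[of "{i, j, k, l}" i k] ij kl B' ev by blast
  qed
  show ?thesis
  proof (cases "2 \<le> card B \<or> 2 \<le> card C")
    case True
    then show ?thesis using pair by blast
  next
    case False
    then have "card B = 1" "card C = 1" using BC by auto
    then obtain j k where jk: "B = {j}" "C = {k}" by (auto simp: card_1_singleton_iff)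
    have "A' \<noteq> {}" using A'(2) by auto
    then obtain i where i: "i \<in> A'" by blast
    have dist: "i \<noteq> j" "i \<noteq> k" "j \<noteq> k"
      using i jk A'(1) classes_disjoint[OF cl] by auto
    have "2 dvd sum c {i, j, k}"
      using even_triple[OF cl, of i j k] i jk A'(1) dist by (auto simp: add.assoc)
    moreover have "\<not> 2 dvd c i + c j"
      using classes_different(1)[OF cl, of i j] i jk A'(1) by auto
    ultimately show ?thesis using that[of "{i, j, k}" i j] i jk by blast
  qed
qed

text \<open>The subset sums of \<open>g p\<close> and \<open>g q\<close> cover all residues modulo
  2, so they turn any even sum of the lowest level into a multiple of 4. This needs an even sum
  meeting two classes; if five coefficients share a class, they and \<open>p\<close>,
  \<open>q\<close> make seven instead.\<close>

lemma solvable_two_levels_distinct: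
  assumes I0: "finite I0" "6 \<le> card I0" "\<And>i. i \<in> I0 \<Longrightarrow> \<not> 2 dvd c i" and disj: "I0 \<inter> I1 = {}"
    and g: "p \<in> I1" "q \<in> I1" "c p = 2 * g p" "c q = 2 * g q" "\<not> 2 dvd g p" "\<not> 2 dvd g q" "\<not> 2 dvd g p + g q"
  shows "solvable I0 I1 c"
proof -
  have "p \<noteq> q" using g by (auto simp flip: mult_2)
  obtain A B C where ABC: "I0 = A \<union> B \<union> C" "classes c A B C" "card B \<le> card A" "card C \<le> card B"
    "card I0 = card A + card B + card C"
    using I0(1,3) by (rule obtain_classes) auto
  show ?thesis
  proof (cases "5 \<le> card A")
    case True
    then have "A \<noteq> {}" by auto
    then obtain i where i: "i \<in> A" by blast
    have "\<not> 4 dvd sum c T" if T: "T \<subseteq> {p, q}" "T \<noteq> {}" for T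
    proof
      assume "4 dvd sum c T"
      moreover have "T = {p} \<or> T = {q} \<or> T = {p, q}" using T by auto
      then have "sum c T = 2 * g p \<or> sum c T = 2 * g q \<or> sum c T = 2 * (g p + g q)"
        using \<open>p \<noteq> q\<close> g by (auto simp: distrib_left)
      moreover have "4 dvd 2 * x \<Longrightarrow> 2 dvd x" for x :: z2_phi
        using dvd_mult_cancel_left[of 2 2 x] by simp
      ultimately show False using g by metis
    qed
    moreover have "card {p, q} = 2" using \<open>p \<noteq> q\<close> by simp
    moreover have "\<forall>j\<in>A. 2 dvd c j + c i" "finite A"
      using classes_same(1)[OF ABC(2) _ i] ABC(2) unfolding classes_def by auto
    moreover have "2 dvd c j" if "j \<in> {p, q}" for j using that g by auto
    ultimately show ?thesis
      by (intro solvable_one_class[of A I0 "{p, q}" I1 "c i" c]) (use True g disj ABC(1) I0(3)[of i] i in auto)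
  next
    case False
    then have "2 \<le> card A" "2 \<le> card B + card C" using ABC(3,4,5) I0(2) by auto
    then obtain S i j where S: "S \<subseteq> A \<union> B \<union> C" "i \<in> S" "j \<in> S" "\<not> 2 dvd c i + c j" "2 dvd sum c S"
      using full_even_subset[OF ABC(2) order_refl] by metis
    then obtain u where u: "sum c S = 2 * u" by blast
    have finS: "finite S" using S(1) I0(1) ABC(1) finite_subset by blast
    have dS: "p \<notin> S" "q \<notin> S" using S(1) ABC(1) g disj by auto
    have "2 dvd u \<or> 2 dvd u + g p \<or> 2 dvd u + g q \<or> 2 dvd u + (g p + g q)"
      using g(5,6,7) unfolding parity_simps by blast
    moreover have "\<exists>T\<subseteq>{p, q}. sum c (S \<union> T) = 4 * z" if "u + x = 2 * z" "x = 0 \<or> x = g p \<or> x = g q \<or> x = g p + g q" for x z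
    proof -
      have "4 * z = 2 * u + 2 * x" using that(1) by (simp flip: distrib_left)
      then have "sum c (S \<union> {}) = 4 * z \<or> sum c (S \<union> {p}) = 4 * z \<or> sum c (S \<union> {q}) = 4 * z \<or> sum c (S \<union> {p, q}) = 4 * z"
        using that(2) finS dS \<open>p \<noteq> q\<close> g u by (auto simp: algebra_simps)
      then show ?thesis by (metis empty_subsetI insert_subset insertI1 insert_commute order_refl)
    qed
    ultimately obtain T z where T: "T \<subseteq> {p, q}" "sum c (S \<union> T) = 4 * z"
      unfolding dvd_def by (metis add_0_right)
    then show ?thesis
      using solvable_full[of "S \<union> T" I0 I1 i j c z] S ABC(1) g(1,2) I0(3) by blast
  qed
qed

text \<open>If an even sum \<open>2 * u\<close> meets two classes and \<open>u\<close> is near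
  \<open>\<beta>\<close>, then adding \<open>b\<close> if necessary makes it divisible by 4.
  Assuming that this never happens, the parity of nearness is compared on disjoint sums and their
  unions.\<close>

lemma solvable_level_0_7:
  assumes I0: "finite I0" "7 \<le> card I0" "\<And>i. i \<in> I0 \<Longrightarrow> \<not> 2 dvd c i" and disj: "I0 \<inter> I1 = {}"
    and b: "b \<in> I1" "c b = 2 * \<beta>" "\<not> 2 dvd \<beta>"
  shows "solvable I0 I1 c"
proof (rule ccontr)
  assume unsolv: "\<not> solvable I0 I1 c"
  have b4: "\<not> 4 dvd c b"
    using dvd_mult_cancel_left[of 2 2 \<beta>] b by simp
  have bI0: "b \<notin> I0" using b(1) disj by blast
  obtain A B C where ABC: "I0 = A \<union> B \<union> C" "classes c A B C" "card B \<le> card A" "card C \<le> card B"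
    "card I0 = card A + card B + card C"
    using I0(1,3) by (rule obtain_classes) auto
  have fin: "finite A" "finite B" "finite C" using ABC(2) unfolding classes_def by auto
  have disjABC: "A \<inter> B = {}" "A \<inter> C = {}" "B \<inter> C = {}" using classes_disjoint[OF ABC(2)] by auto
  have full: "\<not> near \<beta> u" if S: "S \<subseteq> I0" "i \<in> S" "j \<in> S" "\<not> 2 dvd c i + c j" and u: "sum c S = 2 * u" for S i j u
  proof
    assume "near \<beta> u"
    have "finite S" using S(1) I0(1) finite_subset by blast
    have "b \<notin> S" using S(1) bI0 by blast
    have "\<exists>T\<subseteq>{b}. \<exists>z. sum c (S \<union> T) = 4 * z"
      using \<open>near \<beta> u\<close>
    proof (cases rule: near_cases)
      case (even r)
      then have "sum c (S \<union> {}) = 4 * r" by (simp add: u)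
      then show ?thesis by blast
    next
      case (odd r)
      have "sum c (S \<union> {b}) = 4 * r"
        using \<open>finite S\<close> \<open>b \<notin> S\<close> unfolding Un_insert_right Un_empty_right
        by (simp add: b(2) u odd algebra_simps)
      then show ?thesis by blast
    qed
    then obtain T z where "T \<subseteq> {b}" "sum c (S \<union> T) = 4 * z" by blast
    then have "solvable I0 I1 c"
      using solvable_full[of "S \<union> T" I0 I1 i j c z] S b(1) I0(3) by blast
    then show False using unsolv by blast
  qed
  have un: "sum c (S \<union> T) = 2 * (u + v)" if "S \<subseteq> I0" "T \<subseteq> I0" "S \<inter> T = {}" "sum c S = 2 * u" "sum c T = 2 * v" for S T u v
    using that I0(1) by (simp add: sum.union_disjoint finite_subset distrib_left)
  consider "6 \<le> card A" | "4 \<le> card A" "card A \<le> 5" | "card A \<le> 3" by linarith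
  then show False
  proof cases
    case 1
    then have "A \<noteq> {}" by auto
    then obtain i where i: "i \<in> A" by blast
    have "\<forall>j\<in>A. 2 dvd c j + c i" using classes_same(1)[OF ABC(2) _ i] by blast
    moreover have "\<not> 4 dvd sum c T" if "T \<subseteq> {b}" "T \<noteq> {}" for T
      using b4 that by (auto simp: subset_singleton_iff)
    ultimately have "solvable I0 I1 c"
      using solvable_one_class[of A I0 "{b}" I1 "c i" c] 1 b disj ABC(1) I0(3)[of i] i fin by auto
    then show False using unsolv by blast
  next
    case 2
    \<comment> \<open>Neither an even set meeting two classes nor its union with \<open>i\<close>
      and \<open>j\<close> has half-sum near \<open>\<beta>\<close>, so the half-sum of the pair
      itself is near.\<close>
    have pair: "near \<beta> u" if ij: "i \<in> A" "j \<in> A" "i \<noteq> j" and u: "c i + c j = 2 * u" for i j u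
    proof -
      have "2 \<le> card (A - {i, j})" using 2 ij fin by (simp add: card_Diff_subset)
      moreover have "2 \<le> card B + card C" using 2 ABC(5) I0(2) by linarith
      ultimately obtain S k l where S: "S \<subseteq> A - {i, j} \<union> B \<union> C" "k \<in> S" "l \<in> S" "\<not> 2 dvd c k + c l" "2 dvd sum c S"
        using full_even_subset[OF ABC(2), of "A - {i, j}"] by (metis Diff_subset)
      then obtain v where v: "sum c S = 2 * v" by blast
      have SI: "S \<subseteq> I0" "S \<inter> {i, j} = {}" using S(1) ABC(1) disjABC ij by auto
      have "sum c (S \<union> {i, j}) = 2 * (v + u)"
        by (rule un[OF SI(1) _ SI(2) v]) (use ij u ABC(1) in auto)
      then have "\<not> near \<beta> (v + u)"
        by (rule full[of _ k l, rotated 4]) (use SI S ij ABC(1) in auto)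
      moreover have "\<not> near \<beta> v" using full[OF SI(1) S(2,3,4) v] .
      ultimately show ?thesis using near_add[OF b(3)] by blast
    qed
    have "3 \<le> card A" using 2 by simp
    then obtain i k l where ikl: "i \<in> A" "k \<in> A" "l \<in> A" "i \<noteq> k" "i \<noteq> l" "k \<noteq> l" by (rule obtain_three)
    have odd_i: "\<not> 2 dvd c i" using ikl ABC(1) I0(3) by blast
    have "\<exists>p. c j = c i + 2 * p" if "j \<in> A" for j
    proof -
      have "2 dvd c j - c i"
        using classes_same(1)[OF ABC(2) that ikl(1)] even_uminus_add_iff by blast
      then obtain p where "c j - c i = 2 * p" by blast
      then have "c j = c i + 2 * p" by (simp add: algebra_simps)
      then show ?thesis by blast
    qed
    then obtain p where p: "\<And>j. j \<in> A \<Longrightarrow> c j = c i + 2 * p j" by metis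
    have near_p: "near \<beta> (c i) \<longleftrightarrow> near \<beta> (p j)" if "j \<in> A" "j \<noteq> i" for j
      using pair[of i j "c i + p j"] that ikl(1) p[of j] near_add[OF b(3)] by (simp add: algebra_simps)
    \<comment> \<open>The pairs with \<open>i\<close> give \<open>p k\<close> and \<open>p l\<close>
      the parity of \<open>c i\<close>; these cancel in the pair \<open>k\<close>, \<open>l\<close>,
      so \<open>c i\<close> is near \<open>\<beta>\<close>.\<close>
    have "near \<beta> (c i + (p k + p l))"
      using pair[of k l] p[of k] p[of l] ikl by (simp add: algebra_simps)
    then have "near \<beta> (c i)" using near_p[of k] near_p[of l] ikl near_add[OF b(3)] by metis
    then have i\<beta>: "2 dvd c i + \<beta>" using odd_i unfolding near_def by blast
    \<comment> \<open>All corrections \<open>p j\<close> and \<open>\<beta>\<close> are now near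
      \<open>c i\<close>, so \<open>A\<close> and \<open>b\<close> lie in the smaller lattice, where
      five elements suffice.\<close>
    have lat: "c j \<in> lat (c i) 2" if "j \<in> A \<union> {b}" for j
    proof (cases "j = i")
      case True
      then show ?thesis by (intro latI[of _ 1 _ _ 0]) simp
    next
      case False
      have "\<exists>x e. c j = of_int e * c i + 2 * x \<and> near (c i) x"
      proof (cases "j = b")
        case True
        have "near \<beta> \<beta>" by simp
        then have "near (c i) \<beta>" using near_cong[OF i\<beta>] by blast
        then show ?thesis using True b(2) by (intro exI[of _ \<beta>] exI[of _ 0]) simp
      next
        case jb: False
        then have "j \<in> A" using that by blast
        then have "near (c i) (p j)"
          using near_p[of j] False \<open>near \<beta> (c i)\<close> near_cong[OF i\<beta>] by blast
        then show ?thesis using p[OF \<open>j \<in> A\<close>] by (intro exI[of _ "p j"] exI[of _ 1]) simp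
      qed
      then obtain x e where x: "c j = of_int e * c i + 2 * x" "near (c i) x" by blast
      from x(2) show ?thesis
      proof (cases rule: near_cases)
        case (even r)
        then show ?thesis using x(1) by (intro latI[of _ e _ _ r]) simp
      next
        case (odd r)
        show ?thesis
          by (rule latI[of _ "e - 2" _ _ r]) (unfold x(1) odd, simp add: algebra_simps)
      qed
    qed
    have "b \<notin> A" using bI0 ABC(1) by blast
    then have "5 \<le> card (A \<union> {b})"
      using 2(1) fin(1) by simp
    then obtain S z where S: "S \<subseteq> A \<union> {b}" "S \<noteq> {}" "sum c S = 4 * z" "near (c i) z"
      using quarter_sum_near[of "A \<union> {b}" "c i" c] odd_i lat by metis
    have "S \<noteq> {b}" using S(3) b4 by auto
    then obtain j where j: "j \<in> S" "j \<in> A" using S(1,2) by blast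
    have "2 dvd c i + c j" using classes_same(1)[OF ABC(2) ikl(1) j(2)] .
    then have "near (c j) z" using near_cong S(4) by blast
    then have "solvable I0 I1 c"
      using solvable_near[of S I0 I1 j c z] S j ABC(1) b(1) by blast
    then show False using unsolv by blast
  next
    case 3
    \<comment> \<open>The classes have at least the sizes 3, 2, 2 or 3, 3, 1. The first gives two
      disjoint triples, the second a triple and two pairs.\<close>
    then have card: "card A = 3" "2 \<le> card B" "1 \<le> card C" "card C = 1 \<Longrightarrow> card B = 3" using ABC(3,4,5) I0(2) by auto
    have "3 \<le> card A" using card by simp
    then obtain a1 a2 a3 where a: "a1 \<in> A" "a2 \<in> A" "a3 \<in> A" "a1 \<noteq> a2" "a1 \<noteq> a3" "a2 \<noteq> a3" by (rule obtain_three)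
    note diff = classes_different(1)[OF ABC(2)]
    have trip: "\<exists>u. sum c {x, y, z} = 2 * u" if "x \<in> A" "y \<in> B" "z \<in> C" for x y z
    proof -
      have "x \<noteq> y" "x \<noteq> z" "y \<noteq> z" using that disjABC by auto
      then have "sum c {x, y, z} = c x + c y + c z" by (simp add: add.assoc)
      then show ?thesis using even_triple[OF ABC(2) that] by (auto simp: dvd_def)
    qed
    show False
    proof (cases "card C = 1")
      case False
      then have "2 \<le> card C" using card(3) by simp
      then obtain c1 c2 where cc: "c1 \<in> C" "c2 \<in> C" "c1 \<noteq> c2" by (rule obtain_two)
      obtain b1 b2 where bb: "b1 \<in> B" "b2 \<in> B" "b1 \<noteq> b2" using card(2) by (rule obtain_two)
      obtain u v where u: "sum c {a1, b1, c1} = 2 * u" and v: "sum c {a2, b2, c2} = 2 * v"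
        using trip a bb cc by meson
      have sub: "{a1, b1, c1} \<subseteq> I0" "{a2, b2, c2} \<subseteq> I0" "{a1, b1, c1} \<inter> {a2, b2, c2} = {}"
        using a bb cc ABC(1) disjABC by auto
      have "\<not> near \<beta> u" "\<not> near \<beta> v"
        using full[OF sub(1) _ _ _ u, of a1 b1] full[OF sub(2) _ _ _ v, of a2 b2] diff a bb by auto
      moreover have "\<not> near \<beta> (u + v)"
        using full[OF _ _ _ _ un[OF sub u v], of a1 b1] diff a bb sub by auto
      ultimately show False using near_add[OF b(3)] by blast
    next
      case True
      then have "3 \<le> card B" using card by simp
      then obtain b1 b2 b3 where bb: "b1 \<in> B" "b2 \<in> B" "b3 \<in> B" "b1 \<noteq> b2" "b1 \<noteq> b3" "b2 \<noteq> b3" by (rule obtain_three)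
      obtain c1 where c1: "c1 \<in> C" using True by fastforce
      obtain u where u: "sum c {a1, b1, c1} = 2 * u" using trip a bb c1 by meson
      obtain v' where "c a2 + c a3 = 2 * v'" using classes_same(1)[OF ABC(2) a(2,3)] by (rule dvdE)
      then have v: "sum c {a2, a3} = 2 * v'" using a(6) by simp
      obtain w where "c b2 + c b3 = 2 * w" using classes_same(2)[OF ABC(2) bb(2,3)] by (rule dvdE)
      then have w: "sum c {b2, b3} = 2 * w" using bb(6) by simp
      have sub: "{a1, b1, c1} \<subseteq> I0" "{a2, a3} \<subseteq> I0" "{b2, b3} \<subseteq> I0" "{a1, b1, c1} \<inter> {a2, a3} = {}"
        "{a1, b1, c1} \<inter> {b2, b3} = {}" "{a2, a3} \<inter> {b2, b3} = {}"
        using a bb c1 ABC(1) disjABC by auto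
      \<comment> \<open>The sets for \<open>u\<close>, \<open>u + v'\<close> and
        \<open>u + w\<close> force \<open>v'\<close> and \<open>w\<close> to be near, hence also
        \<open>v' + w\<close>, although the union of the two pairs meets two classes.\<close>
      have "\<not> near \<beta> u" using full[OF sub(1) _ _ _ u, of a1 b1] diff a bb by auto
      moreover have "\<not> near \<beta> (u + v')"
        using full[OF _ _ _ _ un[OF sub(1,2,4) u v], of a1 b1] diff a bb sub by auto
      moreover have "\<not> near \<beta> (u + w)"
        using full[OF _ _ _ _ un[OF sub(1,3,5) u w], of a1 b1] diff a bb sub by auto
      moreover have "\<not> near \<beta> (v' + w)"
        using full[OF _ _ _ _ un[OF sub(2,3,6) v w], of a2 b2] diff a bb sub by auto
      ultimately show False using near_add[OF b(3)] by metis
    qed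
  qed
qed

text \<open>Two coefficients whose sum is 2 times a unit can be merged into one of the next level,
  leaving seven. If no such pair exists, congruent pairs sum to multiples of 4, and a pair from each
  of two classes works unless seven coefficients share a class.\<close>

lemma solvable_level_0_9:
  assumes I0: "finite I0" "9 \<le> card I0" "\<And>i. i \<in> I0 \<Longrightarrow> \<not> 2 dvd c i"
  shows "solvable I0 {} c"
proof -
  obtain A B C where ABC: "I0 = A \<union> B \<union> C" "classes c A B C" "card B \<le> card A" "card C \<le> card B"
    "card I0 = card A + card B + card C"
    using I0(1,3) by (rule obtain_classes) auto
  show ?thesis
  proof (cases "\<exists>i\<in>I0. \<exists>j\<in>I0. i \<noteq> j \<and> 2 dvd c i + c j \<and> \<not> 4 dvd c i + c j")
    case True
    then obtain i j \<beta> where ij: "i \<in> I0" "j \<in> I0" "i \<noteq> j" "c i + c j = 2 * \<beta>" "\<not> 4 dvd 2 * \<beta>" by (auto simp: dvd_def)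
    have odd: "\<not> 2 dvd \<beta>" using ij(5) dvd_mult_cancel_left[of 2 2 \<beta>] by auto
    define c' where "c' = c(i := c i + c j)"
    have "7 \<le> card (I0 - {i, j})" using I0(1,2) ij by (simp add: card_Diff_subset)
    then have "solvable (I0 - {i, j}) {i} c'"
      by (intro solvable_level_0_7[of _ c' "{i}" i \<beta>]) (use I0 ij odd in \<open>auto simp: c'_def\<close>)
    then obtain S W where S: "S \<subseteq> (I0 - {i, j}) \<union> {i}" "W \<subseteq> S \<inter> (I0 - {i, j})" "S \<inter> (I0 - {i, j}) \<noteq> {}"
      "8 dvd sum c' S + 4 * sum c' W"
      unfolding solvable_def by blast
    have W: "sum c' W = sum c W" using S(2) by (intro sum.cong) (auto simp: c'_def)
    have finS: "finite S" using S(1) I0(1) by (auto intro: finite_subset)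
    have "\<exists>S'. S \<subseteq> S' \<and> S' \<subseteq> I0 \<and> sum c S' = sum c' S"
    proof (cases "i \<in> S")
      case True
      have "j \<notin> S" using S(1) ij by auto
      have "sum c (insert j S) = c j + (c i + sum c (S - {i}))"
        using True finS \<open>j \<notin> S\<close> by (simp add: sum.remove)
      moreover have "sum c' S = c' i + sum c' (S - {i})" using True finS by (simp add: sum.remove)
      moreover have "sum c' (S - {i}) = sum c (S - {i})" by (intro sum.cong) (auto simp: c'_def)
      ultimately have "sum c (insert j S) = sum c' S" by (simp add: c'_def add_ac)
      then show ?thesis using S(1) ij by blast
    next
      case False
      then have "sum c S = sum c' S" by (intro sum.cong) (auto simp: c'_def)
      then show ?thesis using S(1) False by blast
    qed
    then obtain S' where S': "S \<subseteq> S'" "S' \<subseteq> I0" "sum c S' = sum c' S" by blast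
    have "S' \<subseteq> I0 \<union> {}" "W \<subseteq> S' \<inter> I0" "S' \<inter> I0 \<noteq> {}" "8 dvd sum c S' + 4 * sum c W"
      using S S' W by auto
    then show ?thesis unfolding solvable_def by blast
  next
    case False
    have four: "\<exists>z. c i + c j = 4 * z" if "i \<in> X" "j \<in> X" "i \<noteq> j" "X = A \<or> X = B" for i j X
    proof -
      have "2 dvd c i + c j" using that classes_same(1,2)[OF ABC(2), of i j] by blast
      moreover have "i \<in> I0" "j \<in> I0" using that ABC(1) by auto
      ultimately have "4 dvd c i + c j" using False that by blast
      then show ?thesis by (auto elim: dvdE)
    qed
    show ?thesis
    proof (cases "7 \<le> card A")
      case True
      then have "A \<noteq> {}" by auto
      then obtain i where i: "i \<in> A" by blast
      have "\<forall>j\<in>A. 2 dvd c j + c i" "finite A"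
        using classes_same(1)[OF ABC(2) _ i] ABC(2) unfolding classes_def by auto
      then show ?thesis
        using solvable_one_class[of A I0 "{}" "{}" "c i" c] True ABC(1) I0(3)[of i] i by auto
    next
      case False
      then have "2 \<le> card A" "2 \<le> card B" using ABC(3,4,5) I0(2) by auto
      then obtain a1 a2 b1 b2 where ab: "a1 \<in> A" "a2 \<in> A" "a1 \<noteq> a2" "b1 \<in> B" "b2 \<in> B" "b1 \<noteq> b2"
        by (metis obtain_two)
      obtain y z where "c a1 + c a2 = 4 * y" "c b1 + c b2 = 4 * z" using four ab by metis
      moreover have "a1 \<noteq> b1" "a1 \<noteq> b2" "a2 \<noteq> b1" "a2 \<noteq> b2" using ab classes_disjoint[OF ABC(2)] by auto
      moreover from this have "sum c {a1, a2, b1, b2} = (c a1 + c a2) + (c b1 + c b2)" using ab by (simp add: add.assoc)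
      ultimately have "sum c {a1, a2, b1, b2} = 4 * (y + z)" by (simp add: distrib_left)
      moreover have "\<not> 2 dvd c a1 + c b1" using classes_different(1)[OF ABC(2) ab(1,4)] .
      ultimately show ?thesis
        using solvable_full[of "{a1, a2, b1, b2}" I0 "{}" a1 b1 c "y + z"] ab ABC(1) I0(3) by auto
    qed
  qed
qed

text \<open>A sum \<open>2 * u\<close> of the lowest level is combined with subsets \<open>T\<close>
  of the next. If all of them fail, then the units of the next level lie in
  \<open>lat \<beta> 2\<close>, and that level alone is solvable.\<close>

lemma solvable_two_levels_same:
  assumes I0: "finite I0" "5 \<le> card I0" "\<And>i. i \<in> I0 \<Longrightarrow> \<not> 2 dvd c i" and disj: "I0 \<inter> I1 = {}"
    and I1: "finite I1" "5 \<le> card I1" "\<And>i. i \<in> I1 \<Longrightarrow> c i = 2 * g i" "\<And>i. i \<in> I1 \<Longrightarrow> \<not> 2 dvd g i"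
      "\<And>i j. i \<in> I1 \<Longrightarrow> j \<in> I1 \<Longrightarrow> 2 dvd g i + g j"
  shows "solvable I0 I1 c \<or> solvable I1 {} g"
proof (subst disj_commute, rule disjCI)
  assume unsolv: "\<not> solvable I0 I1 c"
  have "3 \<le> card I1" using I1(2) by simp
  then obtain i0 k l where ikl: "i0 \<in> I1" "k \<in> I1" "l \<in> I1" "i0 \<noteq> k" "i0 \<noteq> l" "k \<noteq> l" by (rule obtain_three)
  define \<beta> where "\<beta> = g i0"
  have odd_\<beta>: "\<not> 2 dvd \<beta>" using I1(4) ikl(1) by (simp add: \<beta>_def)
  have "\<exists>p. g j = \<beta> + 2 * p" if "j \<in> I1" for j
  proof -
    have "2 dvd g j - \<beta>"
      using I1(5)[OF that ikl(1)] even_uminus_add_iff unfolding \<beta>_def by blast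
    then obtain p where "g j - \<beta> = 2 * p" by blast
    then have "g j = \<beta> + 2 * p" by (simp add: algebra_simps)
    then show ?thesis by blast
  qed
  then obtain p where p: "\<And>j. j \<in> I1 \<Longrightarrow> g j = \<beta> + 2 * p j" by metis
  have p0: "p i0 = 0" using p[OF ikl(1)] by (simp add: \<beta>_def)
  \<comment> \<open>Subset sums of the \<open>g j\<close> are only 0 or \<open>\<beta>\<close>
    modulo 2, so \<open>u\<close> must be near \<open>\<beta>\<close> for a correction to be
    possible.\<close>
  obtain S u where S: "S \<subseteq> I0" "S \<noteq> {}" "sum c S = 2 * u" "near \<beta> u"
    using I0(2) odd_\<beta> by (rule half_sum_near)
  obtain i where i: "i \<in> S" using S(2) by blast
  define a where "a = c i"
  have odd_a: "\<not> 2 dvd a" using I0(3) S(1) i by (auto simp: a_def)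
  have no: "\<not> near a z" if T: "T \<subseteq> I1" and z: "u + sum g T = 2 * z" for T z
  proof
    assume near: "near a z"
    have fin: "finite S" "finite T" using S(1) T I0(1) I1(1) finite_subset by auto
    have "sum c T = 2 * sum g T"
      using T I1(3) by (simp add: sum_distrib_left subset_iff)
    moreover have "S \<inter> T = {}" using S(1) T disj by blast
    ultimately have "sum c (S \<union> T) = 2 * (u + sum g T)"
      using fin by (simp add: sum.union_disjoint S(3) distrib_left)
    then have "sum c (S \<union> T) = 4 * z" by (simp add: z)
    then have "solvable I0 I1 c"
      using solvable_near[of "S \<union> T" I0 I1 i c z] S(1) T i near unfolding a_def by blast
    then show False using unsolv by blast
  qed
  note near_a = near_add[OF odd_a]
  have no0: "\<not> near a z" if "u = 2 * z" for z
    using no[of "{}" z] that by simp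
  have no1: "\<not> near a (r + p j)" if "u = - \<beta> + 2 * r" "j \<in> I1" for r j
    using no[of "{j}" "r + p j"] that p[of j] by (simp add: algebra_simps)
  have no2: "\<not> near a (z + \<beta> + p j + p j')" if "u = 2 * z" "j \<in> I1" "j' \<in> I1" "j \<noteq> j'" for z j j'
    using no[of "{j, j'}" "z + \<beta> + p j + p j'"] that p[of j] p[of j'] by (simp add: algebra_simps)
  show "solvable I1 {} g"
  proof (cases "near a \<beta>")
    case True
    then have a\<beta>: "2 dvd a + \<beta>" using odd_\<beta> unfolding near_def by (simp add: add.commute)
    have near_p: "near \<beta> (p j)" if j: "j \<in> I1" for j
    proof (cases "j = i0")
      case True
      then show ?thesis using p0 by simp
    next
      case False
      have "near a (p j)" using S(4)
      proof (cases rule: near_cases)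
        case (even z)
        then show ?thesis
          using no0[of z] no2[of z i0 j] j ikl(1) False \<open>near a \<beta>\<close> p0 near_a by auto
      next
        case (odd r)
        then show ?thesis
          using no1[of r i0] no1[of r j] j ikl(1) p0 near_a by auto
      qed
      then show ?thesis using near_cong[OF a\<beta>] by blast
    qed
    have "g j \<in> lat \<beta> 2" if j: "j \<in> I1" for j
      using near_p[OF j]
    proof (cases rule: near_cases)
      case (even r)
      then show ?thesis by (intro latI[of _ 1 _ _ r]) (simp add: p[OF j])
    next
      case (odd r)
      show ?thesis by (rule latI[of _ "- 1" _ _ r]) (unfold p[OF j] odd, simp add: algebra_simps)
    qed
    then obtain T z where T: "T \<subseteq> I1" "T \<noteq> {}" "sum g T = 4 * z" "near \<beta> z"
      using quarter_sum_near[OF I1(2) odd_\<beta>, of g] by blast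
    then obtain j where j: "j \<in> T" "j \<in> I1" by blast
    have "near (g j) z" using near_cong[OF I1(5)[OF j(2) ikl(1)]] T(4) by (simp add: \<beta>_def)
    then show ?thesis using solvable_near[of T I1 "{}" j g z] T j by simp
  next
    case nb: False
    \<comment> \<open>When \<open>\<beta>\<close> is not near \<open>a\<close>, the parities for the
      empty set and the three pairs from \<open>i0\<close>, \<open>k\<close>, \<open>l\<close> (even
      \<open>u\<close>), or for the three singletons and the triple (odd \<open>u\<close>),
      contradict each other.\<close>
    have False using S(4)
    proof (cases rule: near_cases)
      case (even z)
      then show ?thesis
        using no0[of z] no2[of z i0 k] no2[of z i0 l] no2[of z k l] ikl nb unfolding near_a by auto
    next
      case (odd r)
      have "\<not> near a (r + \<beta> + p i0 + p k + p l)"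
        using no[of "{i0, k, l}" "r + \<beta> + p i0 + p k + p l"] ikl p[of i0] p[of k] p[of l] odd
        by (simp add: algebra_simps)
      then show ?thesis
        using no1[OF odd ikl(1)] no1[OF odd ikl(2)] no1[OF odd ikl(3)] nb unfolding near_a by auto
    qed
    then show ?thesis ..
  qed
qed

text \<open>With six coefficients on the lowest level the next has at least five, in one class or
  several. With seven or more, one coefficient of the next level suffices; if there is none, the
  lowest level has at least eleven.\<close>

lemma solvable_two_levels:
  assumes I0: "finite I0" "6 \<le> card I0" "\<And>i. i \<in> I0 \<Longrightarrow> \<not> 2 dvd c i" and disj: "I0 \<inter> I1 = {}"
    and I1: "finite I1" "11 \<le> card I0 + card I1" "\<And>i. i \<in> I1 \<Longrightarrow> c i = 2 * g i" "\<And>i. i \<in> I1 \<Longrightarrow> \<not> 2 dvd g i"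
  shows "solvable I0 I1 c \<or> solvable I1 {} g"
proof (cases "card I0 = 6")
  case True
  then have "5 \<le> card I0" "5 \<le> card I1" using I1(2) by auto
  show ?thesis
  proof (cases "\<exists>p\<in>I1. \<exists>q\<in>I1. \<not> 2 dvd g p + g q")
    case True
    then obtain p q where "p \<in> I1" "q \<in> I1" "\<not> 2 dvd g p + g q" by blast
    then show ?thesis
      using solvable_two_levels_distinct[OF I0 disj, where p = p and q = q and g = g] I1(3,4) by simp
  next
    case False
    then show ?thesis
      using solvable_two_levels_same[of I0 c I1 g] I0 I1 disj \<open>5 \<le> card I0\<close> \<open>5 \<le> card I1\<close> by blast
  qed
next
  case False
  then have "7 \<le> card I0" using I0(2) by simp
  show ?thesis
  proof (cases "I1 = {}")
    case True
    then have "9 \<le> card I0" using I1(2) by simp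
    then show ?thesis using solvable_level_0_9[of I0 c] I0(1,3) True by blast
  next
    case False
    then obtain b where "b \<in> I1" by blast
    then show ?thesis
      using solvable_level_0_7[of I0 c I1 b "g b"] I0(1,3) \<open>7 \<le> card I0\<close> disj I1(3,4) by blast
  qed
qed

section \<open>From the form modulo 8 to nontrivial zeros\<close>

text \<open>The element is \<open>\<surd>5 = 2 \<phi> - 1\<close>, and for odd \<open>m\<close> the
  power \<open>5 ^ m\<close> is 5 modulo 8 because 25 is 1 modulo 24.\<close>

lemma sqrt_5_power:
  assumes "d = 2 * m" "odd m"
  shows "8 dvd (Z2_phi (- 1) 2) ^ d - 5" "2 dvd Z2_phi (- 1) 2 - 1"
proof -
  obtain k where k: "m = 2 * k + 1" using assms(2) by (rule oddE)
  have of_nat: "of_nat n = Z2_phi (of_nat n) 0" for n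
    by (induction n) (simp_all add: z2_phi_ring_defs)
  have "(Z2_phi (- 1) 2)\<^sup>2 = 5"
    using of_nat[of 5] by (simp add: power2_eq_square times_z2_phi_def)
  then have "(Z2_phi (- 1) 2) ^ d = 5 ^ m" by (simp add: assms(1) power_mult)
  also have "\<dots> = 5 * 25 ^ k" by (simp add: k power_mult)
  finally have "(Z2_phi (- 1) 2) ^ d - 5 = 5 * (25 ^ k - 1 ^ k)" by (simp add: algebra_simps)
  moreover have "(25 :: z2_phi) - 1 dvd 25 ^ k - 1 ^ k" by (rule diff_dvd_power_diff)
  then have "(24 :: z2_phi) dvd 25 ^ k - 1 ^ k" by simp
  then have "(8 :: z2_phi) dvd 25 ^ k - 1 ^ k" by (rule dvd_trans[rotated]) (rule dvdI[of _ _ 3], simp)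
  ultimately show "8 dvd (Z2_phi (- 1) 2) ^ d - 5" by (metis dvd_mult)
  show "2 dvd Z2_phi (- 1) 2 - 1"
    by (simp add: z2_phi_even_iff minus_z2_phi_def one_z2_phi_def)
qed

text \<open>All variables are fixed except one of the lowest level with nonzero value; its
  coefficient and value are units, so Hensel lifting solves for it exactly.\<close>

lemma solvable_imp_zero:
  assumes "finite I0" "finite I1" "\<And>i. i \<in> I0 \<Longrightarrow> \<not> 2 dvd c i" "d = 2 * m" "odd m" "solvable I0 I1 c"
  obtains x i where "i \<in> I0 \<union> I1" "x i \<noteq> 0" "(\<Sum>i\<in>I0 \<union> I1. c i * x i ^ d) = 0"
proof -
  let ?I = "I0 \<union> I1" and ?s = "Z2_phi (- 1) 2"
  obtain S W i where S: "S \<subseteq> ?I" "W \<subseteq> S" "i \<in> S" "i \<in> I0" "8 dvd sum c S + 4 * sum c W"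
    using assms(6) unfolding solvable_def by blast
  have fin: "finite S" "finite W" using S assms(1,2) by (auto intro: finite_subset)
  have "d > 0" using assms(4,5) by (auto elim: oddE)
  define x where "x j = (if j \<in> W then ?s else if j \<in> S then 1 else 0)" for j
  obtain q where "?s ^ d - 5 = 8 * q" using sqrt_5_power(1)[OF assms(4,5)] by blast
  then have q: "?s ^ d = 5 + 8 * q" by (simp add: algebra_simps)
  have "(\<Sum>j\<in>?I. c j * x j ^ d) = (\<Sum>j\<in>S. c j * x j ^ d)"
    using S \<open>d > 0\<close> assms(1,2) by (intro sum.mono_neutral_right) (auto simp: x_def)
  also have "\<dots> = (\<Sum>j\<in>S. c j + (if j \<in> W then c j * (4 + 8 * q) else 0))"
    by (rule sum.cong) (auto simp: x_def q algebra_simps)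
  also have "\<dots> = sum c S + (\<Sum>j\<in>W. c j * (4 + 8 * q))"
    using fin S(2) by (simp add: sum.distrib sum.If_cases Int_absorb1)
  also have "\<dots> = (sum c S + 4 * sum c W) + 8 * (q * sum c W)"
    unfolding sum_distrib_right[symmetric] by (simp add: algebra_simps)
  finally have total: "8 dvd (\<Sum>j\<in>?I. c j * x j ^ d)" using S(5) by simp
  have iI: "i \<in> ?I" using S(4) by blast
  define r where "r = (\<Sum>j\<in>?I - {i}. c j * x j ^ d)"
  have "(\<Sum>j\<in>?I. c j * x j ^ d) = c i * x i ^ d + r"
    unfolding r_def using iI assms(1,2) by (simp add: sum.remove)
  then have "- r - c i * x i ^ d = - (\<Sum>j\<in>?I. c j * x j ^ d)" by simp
  then have "8 dvd - r - c i * x i ^ d" using total by (metis dvd_minus_iff)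
  moreover have "2 dvd x i - 1" using S(3) sqrt_5_power(2)[OF assms(4,5)] by (simp add: x_def)
  ultimately obtain X where X: "2 dvd X - 1" "c i * X ^ d = - r"
    using hensel[OF assms(4,5) assms(3)[OF S(4)]] by metis
  have "X \<noteq> 0" using X(1) z2_phi_odd_one by auto
  have "(\<Sum>j\<in>?I. c j * (x(i := X)) j ^ d) = c i * X ^ d + (\<Sum>j\<in>?I - {i}. c j * (x(i := X)) j ^ d)"
    using iI assms(1,2) by (simp add: sum.remove)
  also have "(\<Sum>j\<in>?I - {i}. c j * (x(i := X)) j ^ d) = r"
    unfolding r_def by (rule sum.cong) auto
  finally have "(\<Sum>j\<in>?I. c j * (x(i := X)) j ^ d) = 0" by (simp add: X(2))
  then show ?thesis using that[of i "x(i := X)"] iI \<open>X \<noteq> 0\<close> by simp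
qed

section \<open>Transfer to \<open>K\<close> and choice of two consecutive levels\<close>

lemma nontrivial_zero_transfer:
  assumes "I \<subseteq> {..<s}" "i \<in> I" "x i \<noteq> 0" "(\<Sum>i\<in>I. c i * x i ^ d) = 0" "d > 0"
    and f: "\<And>i. i \<in> I \<Longrightarrow> f i \<noteq> 0" "\<And>i. i \<in> I \<Longrightarrow> a i * f i ^ d = k * to_K (c i)"
  shows "has_nontrivial_zero d s a"
proof -
  define y where "y j = (if j \<in> I then f j * to_K (x j) else 0)" for j
  have "additive_form d s a y = (\<Sum>j\<in>I. a j * y j ^ d)"
    unfolding additive_form_def using assms(1,5)
    by (intro sum.mono_neutral_right) (auto simp: y_def)
  also have "\<dots> = (\<Sum>j\<in>I. k * to_K (c j * x j ^ d))"
  proof (rule sum.cong)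
    fix j assume "j \<in> I"
    then have "a j * y j ^ d = (a j * f j ^ d) * to_K (x j ^ d)"
      by (simp add: y_def power_mult_distrib to_K_power)
    then show "a j * y j ^ d = k * to_K (c j * x j ^ d)"
      using f(2)[OF \<open>j \<in> I\<close>] by (simp add: to_K_mult)
  qed simp
  also have "\<dots> = k * to_K (\<Sum>j\<in>I. c j * x j ^ d)"
    by (simp add: to_K_sum sum_distrib_left)
  finally have "additive_form d s a y = 0" by (simp add: assms(4))
  moreover have "i < s" "y i \<noteq> 0" using assms(1-3) f(1) by (auto simp: y_def)
  ultimately show ?thesis unfolding has_nontrivial_zero_def by blast
qed

text \<open>If no level qualifies, the excess of each over 5 is at most the deficit of the next
  below 5. Summed around the cycle this bounds the total by \<open>5 * d\<close>.\<close>

lemma cyclic_pigeonhole: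
  fixes M :: "nat \<Rightarrow> nat"
  assumes "5 * d < (\<Sum>j<d. M j)"
  shows "\<exists>j<d. 6 \<le> M j \<and> 11 \<le> M j + M (Suc j mod d)"
proof (rule ccontr)
  assume no: "\<not> ?thesis"
  \<comment> \<open>Subtraction truncates at zero, so a level with at most five variables has no
    excess.\<close>
  have "M j - 5 \<le> 5 - M (Suc j mod d)" if j: "j < d" for j
  proof (rule ccontr)
    assume "\<not> ?thesis"
    then have "6 \<le> M j" "11 \<le> M j + M (Suc j mod d)" by linarith+
    then show False using j no by blast
  qed
  then have "(\<Sum>j<d. M j - 5) \<le> (\<Sum>j<d. 5 - M (Suc j mod d))"
    by (intro sum_mono) simp
  also have "\<dots> = (\<Sum>j<d. 5 - M j)"
  proof (cases d)
    case (Suc n)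
    have "(\<Sum>j<Suc n. 5 - M (Suc j mod Suc n)) = (\<Sum>j<n. 5 - M (Suc j)) + (5 - M 0)"
      by simp
    also have "\<dots> = (\<Sum>j<Suc n. 5 - M j)"
      unfolding sum.lessThan_Suc_shift by simp
    finally show ?thesis by (simp only: Suc)
  qed simp
  moreover have "(\<Sum>j<d. M j) + (\<Sum>j<d. 5 - M j) = (\<Sum>j<d. 5) + (\<Sum>j<d. M j - 5)"
    unfolding sum.distrib[symmetric] by (rule sum.cong) auto
  ultimately show False using assms by simp
qed

lemma additive_form_nontrivial_zero:
  fixes a :: "nat \<Rightarrow> q2_sqrt5"
  assumes d: "d = 2 * m" "odd m" and s: "5 * d + 1 \<le> s"
  shows "has_nontrivial_zero d s a"
proof (cases "\<exists>i<s. a i = 0")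
  case True
  then obtain i where i: "i < s" "a i = 0" by blast
  have "d > 0" using d by (auto elim: oddE)
  then have "additive_form d s a (\<lambda>j. if j = i then 1 else 0) = 0"
    unfolding additive_form_def using i(2) by (intro sum.neutral) auto
  then show ?thesis
    unfolding has_nontrivial_zero_def using i(1)
    by (intro exI[of _ "\<lambda>j. if j = i then 1 else 0"] conjI exI[of _ i]) simp_all
next
  case False
  have d2: "2 \<le> d" "d > 0" using d by (auto elim: oddE)
  define P where "P i e l u \<longleftrightarrow> e \<noteq> 0 \<and> l < d \<and> \<not> 2 dvd u \<and> a i * e ^ d = 2 ^ l * to_K u" for i e l u
  have "\<exists>e l u. P i e l u" if "i < s" for i
  proof -
    have "a i \<noteq> 0" using False that by blast
    then show ?thesis using d2(2) by (rule K_normal_form) (auto simp: P_def)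
  qed
  then obtain e l u where "\<And>i. i < s \<Longrightarrow> P i (e i) (l i) (u i)" by metis
  then have elu: "\<And>i. i < s \<Longrightarrow> e i \<noteq> 0" "\<And>i. i < s \<Longrightarrow> l i < d" "\<And>i. i < s \<Longrightarrow> \<not> 2 dvd u i"
    "\<And>i. i < s \<Longrightarrow> a i * e i ^ d = 2 ^ l i * to_K (u i)"
    by (simp_all add: P_def)
  define L where "L j = {i. i < s \<and> l i = j}" for j
  have fin: "finite (L j)" for j by (simp add: L_def)
  have "{..<s} = (\<Union>j<d. L j)" using elu(2) by (auto simp: L_def)
  then have "s = card (\<Union>j<d. L j)" by (metis card_lessThan)
  also have "\<dots> = (\<Sum>j<d. card (L j))"
    by (rule card_UN_disjoint) (auto simp: L_def)
  finally have "5 * d < (\<Sum>j<d. card (L j))" using s by simp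
  then obtain j where j: "j < d" "6 \<le> card (L j)" "11 \<le> card (L j) + card (L (Suc j mod d))"
    using cyclic_pigeonhole by blast
  let ?j' = "Suc j mod d"
  have "j \<noteq> ?j'" using j(1) d2(1) by (cases "Suc j = d") auto
  \<comment> \<open>Coefficients relative to level \<open>j\<close>: the next level contributes an
    additional factor 2.\<close>
  define c where "c i = (if l i = j then u i else 2 * u i)" for i
  have c0: "\<not> 2 dvd c i" if "i \<in> L j" for i using that elu(3) by (simp add: L_def c_def)
  have c1: "c i = 2 * u i" if "i \<in> L ?j'" for i using that \<open>j \<noteq> ?j'\<close> by (simp add: L_def c_def)
  have u1: "\<not> 2 dvd u i" if "i \<in> L ?j'" for i using that elu(3) by (simp add: L_def)
  have K2: "(2 :: q2_sqrt5) \<noteq> 0" using to_K_eq_0_iff[of 2] by (simp add: to_K_2)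
  have "L j \<inter> L ?j' = {}" using \<open>j \<noteq> ?j'\<close> by (auto simp: L_def)
  then have "solvable (L j) (L ?j') c \<or> solvable (L ?j') {} u"
    using solvable_two_levels[of "L j" c "L ?j'" u] fin j(2,3) c0 c1 u1 by blast
  then show ?thesis
  proof
    assume sol: "solvable (L j) (L ?j') c"
    obtain x i where x: "i \<in> L j \<union> L ?j'" "x i \<noteq> 0" "(\<Sum>i\<in>L j \<union> L ?j'. c i * x i ^ d) = 0"
      by (rule solvable_imp_zero[of "L j" "L ?j'" c d m, OF fin fin c0 d sol])
    \<comment> \<open>When \<open>j = d - 1\<close> the next level is 0; doubling its variables
      multiplies the coefficients by \<open>2 ^ d\<close> and lifts it to level
      \<open>Suc j\<close>. The test \<open>l i \<noteq> j\<close> leaves level 0 alone when it is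
      the lowest level itself.\<close>
    define f where "f i = (if l i = 0 \<and> l i \<noteq> j then 2 * e i else e i)" for i
    have "f i \<noteq> 0" if "i \<in> L j \<union> L ?j'" for i
      using that elu(1) K2 by (auto simp: f_def L_def)
    moreover have "a i * f i ^ d = 2 ^ j * to_K (c i)" if i: "i \<in> L j \<union> L ?j'" for i
    proof (cases "l i = j")
      case True
      then show ?thesis using i elu(4)[of i] by (auto simp: f_def c_def L_def)
    next
      case lj: False
      then have li: "l i = ?j'" "i < s" using i by (auto simp: L_def)
      show ?thesis
      proof (cases "Suc j = d")
        case True
        then have "l i = 0" using li by simp
        then have "a i * f i ^ d = 2 ^ d * (a i * e i ^ d)"
          using lj by (simp add: f_def power_mult_distrib)
        also have "\<dots> = 2 ^ Suc j * to_K (u i)"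
          using elu(4)[OF li(2)] \<open>l i = 0\<close> True by simp
        finally show ?thesis using lj by (simp add: c_def to_K_mult to_K_2)
      next
        case False
        then have "l i = Suc j" using li j(1) by simp
        then show ?thesis using elu(4)[OF li(2)] lj by (simp add: f_def c_def to_K_mult to_K_2)
      qed
    qed
    moreover have "L j \<union> L ?j' \<subseteq> {..<s}" by (auto simp: L_def)
    ultimately show ?thesis
      using nontrivial_zero_transfer[of "L j \<union> L ?j'" s i x c d f a "2 ^ j"] x d2(2) by blast
  next
    assume sol: "solvable (L ?j') {} u"
    obtain x i where x: "i \<in> L ?j' \<union> {}" "x i \<noteq> 0" "(\<Sum>i\<in>L ?j' \<union> {}. u i * x i ^ d) = 0"
      by (rule solvable_imp_zero[of "L ?j'" "{}" u d m, OF fin finite.emptyI u1 d sol])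
    have "L ?j' \<union> {} \<subseteq> {..<s}" by (auto simp: L_def)
    then show ?thesis
      by (rule nontrivial_zero_transfer[OF _ x d2(2), of _ e a "2 ^ ?j'"]) (use elu in \<open>auto simp: L_def\<close>)
  qed
qed

theorem theorem3:
  fixes d m :: nat
  assumes "m \<ge> 3" and "odd m" and "d = 2 * m"
  shows "(\<forall>s\<ge>5 * d + 1. \<forall>a :: nat \<Rightarrow> q2_sqrt5. has_nontrivial_zero d s a) \<and>
    Gamma_star d TYPE(q2_sqrt5) \<le> 5 * d + 1"
proof
  show zero: "\<forall>s\<ge>5 * d + 1. \<forall>a :: nat \<Rightarrow> q2_sqrt5. has_nontrivial_zero d s a"
    using additive_form_nontrivial_zero[OF assms(3,2)] by blast
  show "Gamma_star d TYPE(q2_sqrt5) \<le> 5 * d + 1"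
    unfolding Gamma_star_def by (rule Least_le) (rule zero)
qed

end
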